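(* Let $r(t)$ be the covariance function of a stationary zero-mean Gaussian process with unit variance ($r(0)=1$), twice differentiable for $t>0$, such that the following conditions are satisfied for $t>0$: (i) $r(t)\ge 0$; (ii) $r'(t)\le 0$; (iii) $r''(t)\ge -\,(r'(t))^2\,r(t)/(1-r(t)^2)$. Then the approximated switching time distribution obtained by the independent interval approximation (IIA) method belongs to the class $GD(2)$; that is, there is a switching time distribution $F\in GD(2)$ for which the covariance function of the stationary switch process equals $\frac{2}{\pi}\arcsin(r(t))$.
   Context: IIA method: the clipped process of the Gaussian process is its sign process, which has covariance function $C(t)=\frac{2}{\pi}\arcsin(r(t))$. The IIA treats the clipped process as a stationary switch process: the approximated switching time distribution is the switching time distribution $F$ for which the stationary switch process has covariance function $C(t)$. Switch process: let $(T_k)_{k\ge 1}$ be i.i.d. non-negative random variables with distribution function $F$ (the switching time distribution), where $F$ is absolutely continuous with respect to Lebesgue measure with a density $f_T$ that is bounded on any closed interval of the positive half-line, and $F(0)=0$. Define $N(t)=\sup\{n\in\mathbb{N}:\sum_{k=1}^n T_k\le t\}$ for $t\ge T_1$ and $N(t)=0$ for $0\le t<T_1$. The switch process is $X(t)=(-1)^{N(t)}$, $t\ge 0$. Stationary switch process: let $\mu=\mathbb{E}[T_1]$ (finite). Let $X_+,X_-$ be two independent switch processes with switching time distribution $F$. Let $(A,B)$ be a pair of non-negative random variables with joint density $f_{A,B}(a,b)=f_T(a+b)/\mu$ (so that $f_A(t)=f_B(t)=(1-F(t))/\mu$) and let $\delta$ satisfy $P(\delta=1)=P(\delta=-1)=1/2$,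 with $(A,B)$, $\delta$, $X_+$, $X_-$ mutually independent. Define, for $t\in\mathbb{R}$, $Y(t)=-\delta$ if $-B<t<A$; $Y(t)=\delta X_+(t-A)$ if $t\ge A$; $Y(t)=-\delta X_-(-(t+B))$ if $t\le -B$. The process $Y$ is the stationary switch process; its covariance function is $\mathrm{Cov}(Y(t),Y(0))=\mathbb{E}[Y(t)Y(0)]$. Geometric divisibility: for $r_0>1$, a distribution $F$ of a non-negative random variable $W$ belongs to $GD(r_0)$ if $W$ has the same distribution as $\sum_{k=1}^{\nu_p}\tilde W_k$, where $\nu_p$ is geometric with $P(\nu_p=k)=(1-p)^{k-1}p$, $k=1,2,\dots$, $r_0=\mathbb{E}\nu_p=1/p$, and $(\tilde W_k)_{k\ge1}$ are i.i.d. non-negative random variables independent of $\nu_p$.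
   Formalization: It is also assumed that 1−r(t)=O(t²) as t→0+ (the claim fails for r(t)=e^{−|t|}) and that r(t)→0 as t→∞; both are necessary for the conclusion. For t≤−B the stationary switch process is taken as +δX₋(−(t+B)), since −δ would leave no switch at −B. *)

theory Defs
  imports "HOL-Probability.Probability"
begin

definition covariance :: "'w measure \<Rightarrow> ('w \<Rightarrow> real) \<Rightarrow> ('w \<Rightarrow> real) \<Rightarrow> real" where
  "covariance M U V =
     (\<integral>\<omega>. (U \<omega> - (\<integral>\<omega>'. U \<omega>' \<partial>M)) * (V \<omega> - (\<integral>\<omega>'. V \<omega>' \<partial>M)) \<partial>M)"


subsection \<open>Stationary Gaussian processes\<close>

text \<open>The point mass at \<open>m\<close> counts as a (degenerate) normal distribution.\<close>

definition normal_rv :: "'w measure \<Rightarrow> ('w \<Rightarrow> real) \<Rightarrow> bool" where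
  "normal_rv M U \<longleftrightarrow> U \<in> borel_measurable M \<and>
     (\<exists>m. (AE \<omega> in M. U \<omega> = m) \<or> (\<exists>\<sigma>>0. distributed M lborel U (normal_density m \<sigma>)))"

definition gaussian_process :: "'w measure \<Rightarrow> (real \<Rightarrow> 'w \<Rightarrow> real) \<Rightarrow> bool" where
  "gaussian_process M Z \<longleftrightarrow> prob_space M \<and>
     (\<forall>J c. finite J \<longrightarrow> normal_rv M (\<lambda>\<omega>. \<Sum>t\<in>J. c t * Z t \<omega>))"

text \<open>Strict stationarity: the finite-dimensional distributions are invariant under time shifts.\<close>

definition stationary_process :: "'w measure \<Rightarrow> (real \<Rightarrow> 'w \<Rightarrow> real) \<Rightarrow> bool" where
  "stationary_process M Z \<longleftrightarrow>
     (\<forall>J h. finite J \<longrightarrow>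
        distr M (\<Pi>\<^sub>M t\<in>J. borel) (\<lambda>\<omega>. \<lambda>t\<in>J. Z (t + h) \<omega>) =
        distr M (\<Pi>\<^sub>M t\<in>J. borel) (\<lambda>\<omega>. \<lambda>t\<in>J. Z t \<omega>))"


subsection \<open>The switch process and its stationary counterpart\<close>

text \<open>
  A switching time distribution is represented by its density \<open>f\<close>; the distribution itself is
  \<open>switching_dist f\<close>. It has no mass on the closed negative half-line, i.e. \<open>F(0) = 0\<close>,
  because \<open>f\<close> vanishes there up to a null set. The positive half-line is \<open>{0<..}\<close>: the density
  may be unbounded near 0.
\<close>

definition switching_density :: "(real \<Rightarrow> real) \<Rightarrow> bool" where
  "switching_density f \<longleftrightarrow>
     f \<in> borel_measurable borel \<and> (\<forall>x. 0 \<le> f x) \<and> (\<forall>x<0. f x = 0) \<and>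
     prob_space (density lborel f) \<and>
     (\<forall>a b. 0 < a \<longrightarrow> bdd_above (f ` {a..b})) \<and>
     integrable lborel (\<lambda>x. x * f x)"

definition switching_dist :: "(real \<Rightarrow> real) \<Rightarrow> real measure" where
  "switching_dist f = density lborel f"

definition switching_mean :: "(real \<Rightarrow> real) \<Rightarrow> real" where
  "switching_mean f = (\<integral>x. x \<partial>switching_dist f)"

text \<open>
  \<open>T k\<close> is the switching time number \<open>k + 1\<close>. For \<open>t \<ge> 0\<close> the set contains 0 (empty sum), and it
  is \<open>{0}\<close> when \<open>t < T 0\<close> and all switching times are non-negative.
\<close>

definition switch_count :: "(nat \<Rightarrow> real) \<Rightarrow> real \<Rightarrow> nat" where
  "switch_count T t = Sup {n. (\<Sum>k<n. T k) \<le> t}"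

definition switch_process :: "(nat \<Rightarrow> real) \<Rightarrow> real \<Rightarrow> real" where
  "switch_process T t = (-1) ^ switch_count T t"

text \<open>
  A sample point consists of the switching times of the right and the left switch process,
  the pair \<open>(A, B)\<close> and the sign \<open>\<delta>\<close>; the four components are independent.
\<close>

type_synonym switch_sample = "(nat \<Rightarrow> real) \<times> (nat \<Rightarrow> real) \<times> (real \<times> real) \<times> real"

definition delay_dist :: "(real \<Rightarrow> real) \<Rightarrow> (real \<times> real) measure" where
  "delay_dist f = density (lborel \<Otimes>\<^sub>M lborel)
     (\<lambda>(a, b). ennreal (if 0 \<le> a \<and> 0 \<le> b then f (a + b) / switching_mean f else 0))"

definition switch_space :: "(real \<Rightarrow> real) \<Rightarrow> switch_sample measure" where
  "switch_space f =
     (\<Pi>\<^sub>M k\<in>(UNIV :: nat set). switching_dist f) \<Otimes>\<^sub>M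
     (\<Pi>\<^sub>M k\<in>(UNIV :: nat set). switching_dist f) \<Otimes>\<^sub>M
     delay_dist f \<Otimes>\<^sub>M
     measure_pmf (pmf_of_set {- 1, 1})"

text \<open>
  The value is \<open>-\<delta>\<close> on \<open>(-B, A)\<close>, so the sign in front of the left switch process has to be
  \<open>\<delta>\<close> (and not \<open>-\<delta>\<close>) for a switch to take place at \<open>-B\<close>; otherwise the process would not be
  stationary.
\<close>

definition stationary_switch_process :: "real \<Rightarrow> switch_sample \<Rightarrow> real" where
  "stationary_switch_process t =
     (\<lambda>(Tr, Tl, (A, B), \<delta>).
        if - B < t \<and> t < A then - \<delta>
        else if A \<le> t then \<delta> * switch_process Tr (t - A)
        else \<delta> * switch_process Tl (- (t + B)))"

definition switch_covariance :: "(real \<Rightarrow> real) \<Rightarrow> real \<Rightarrow> real" where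
  "switch_covariance f t =
     covariance (switch_space f) (stationary_switch_process t) (stationary_switch_process 0)"


subsection \<open>Geometric divisibility\<close>

text \<open>
  \<open>geometric_pmf p\<close> lives on \<open>{0, 1, ...}\<close>, hence the shift by \<open>Suc\<close>; the mean of the shifted
  distribution is \<open>1 / p = r\<^sub>0\<close>. The class is meant for \<open>r\<^sub>0 > 1\<close>.
\<close>

definition GD :: "real \<Rightarrow> real measure set" where
  "GD r\<^sub>0 = {D. \<exists>G. prob_space G \<and> sets G = sets borel \<and> (AE x in G. 0 \<le> x) \<and>
      D = distr (measure_pmf (map_pmf Suc (geometric_pmf (1 / r\<^sub>0))) \<Otimes>\<^sub>M (\<Pi>\<^sub>M k\<in>(UNIV :: nat set). G))
            borel (\<lambda>(\<nu>, w). \<Sum>k<\<nu>. w k)}"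

end

theory Submission
  imports Defs "HOL-Real_Asymp.Real_Asymp"
begin

text \<open>
  Let \<open>c = 2/pi arcsin r\<close>. Conditions (ii) and (iii) say that \<open>c\<close> is decreasing and convex, and the
  finite second spectral moment makes \<open>D = - c'(0+)\<close> finite. Hence \<open>g = c'' / D\<close> is the density of
  a distribution \<open>G\<close> with \<open>G(t) = 1 + c'(t) / D\<close>. The switching time is a sum of \<open>\<nu>\<close> independent
  variables with law \<open>G\<close>, where \<open>\<nu>\<close> is geometric with mean 2; its density \<open>f\<close> satisfies
  \<open>2 f = g + g * f\<close>. Thus switches form a thinning of a renewal process with interarrival law \<open>G\<close>,
  each renewal being kept with probability 1/2, so that the switch process has mean \<open>1 - G(u)\<close> at
  time \<open>u\<close>. Conditioning on \<open>A\<close> and applying the renewal equation to the tail of \<open>f\<close> shows that the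
  stationary switch process has covariance \<open>1 - D \<integral>\<^sub>0\<^sup>t (1 - G) = c(t)\<close>.

  The density \<open>f\<close> is bounded away from 0 because \<open>g(t) = O(1 + 1/t)\<close>. This bound needs \<open>r''\<close> to be
  bounded, which follows from \<open>|2 r(t) - r(t+h) - r(t-h)| \<le> 2 - 2 r(h) = O(h^2)\<close>.
\<close>

section \<open>Convolution powers and geometric sums\<close>

text \<open>The density \<open>g\<close> is found by working backwards. For a switching time that is
  a geometric sum with summand law G of mean m, the stationary covariance comes out as 1 - (integral
  of 1 - G over [0, t]) / m. Equating this with c forces 1 - G = - m c', hence m = 1 / D. Since r
  vanishes at infinity, - c' integrates to 1, which makes 1 / D the mean of this G.

  The mean 2 of \<open>\<nu>\<close> is what makes the parity of the number of switches fair after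
  the first renewal, so that only the event of no renewal contributes to the mean of the switch
  process.

  The obstacle is the infinite slope of arcsin at 1: c'' contains the factor 1 / sqrt(1 - r^2),
  which can grow like 1/t, so \<open>g\<close> may be unbounded near 0. A bound on \<open>f\<close>
  away from 0 therefore has to survive all convolution powers. The shape L (1 + 1/x) does, with
  constants growing polynomially in the number of summands, and the geometric weights absorb them.

  Densities, distribution functions and tails are \<open>ennreal\<close>-valued, so that Tonelli
  requires no integrability. The price is the lack of subtraction: identities are proved in additive
  form and finite terms are cancelled at the end.\<close>

definition convol :: "(real \<Rightarrow> ennreal) \<Rightarrow> (real \<Rightarrow> ennreal) \<Rightarrow> real \<Rightarrow> ennreal" where
  "convol g h x = (\<integral>\<^sup>+y. g y * h (x - y) \<partial>lborel)"

lemma borel_measurable_convol [measurable]: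
  assumes [measurable]: "g \<in> borel_measurable borel" "h \<in> borel_measurable borel"
  shows "convol g h \<in> borel_measurable borel"
  unfolding convol_def by measurable

text \<open>Tonelli and the substitution x = z + y. For densities this is the expectation of
  \<open>h\<close> at a sum of two independent variables, the form in which all renewal identities
  below are used.\<close>

lemma nn_integral_convol:
  assumes [measurable]: "g \<in> borel_measurable borel" "f \<in> borel_measurable borel"
    "h \<in> borel_measurable borel"
  shows "(\<integral>\<^sup>+x. convol g f x * h x \<partial>lborel) =
    (\<integral>\<^sup>+z. g z * (\<integral>\<^sup>+y. f y * h (z + y) \<partial>lborel) \<partial>lborel)"
proof -
  have "(\<integral>\<^sup>+x. convol g f x * h x \<partial>lborel) =
      (\<integral>\<^sup>+x. \<integral>\<^sup>+z. g z * f (x - z) * h x \<partial>lborel \<partial>lborel)"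
    unfolding convol_def by (subst nn_integral_multc) auto
  also have "\<dots> = (\<integral>\<^sup>+z. \<integral>\<^sup>+x. g z * f (x - z) * h x \<partial>lborel \<partial>lborel)"
    by (subst lborel_pair.Fubini') auto
  also have "\<dots> = (\<integral>\<^sup>+z. g z * (\<integral>\<^sup>+y. f y * h (z + y) \<partial>lborel) \<partial>lborel)"
  proof (intro nn_integral_cong)
    fix z :: real
    have "(\<integral>\<^sup>+x. g z * f (x - z) * h x \<partial>lborel) = g z * (\<integral>\<^sup>+x. f (x - z) * h x \<partial>lborel)"
      by (simp add: mult.assoc nn_integral_cmult)
    also have "(\<integral>\<^sup>+x. f (x - z) * h x \<partial>lborel) = (\<integral>\<^sup>+y. f y * h (z + y) \<partial>lborel)"
      by (subst nn_integral_real_affine[where c = 1 and t = z]) auto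
    finally show "(\<integral>\<^sup>+x. g z * f (x - z) * h x \<partial>lborel) =
        g z * (\<integral>\<^sup>+y. f y * h (z + y) \<partial>lborel)" .
  qed
  finally show ?thesis .
qed

text \<open>\<open>convol_power g n\<close> is the \<open>(n + 1)\<close>-fold convolution, because the zeroth power has no density.\<close>

fun convol_power :: "(real \<Rightarrow> ennreal) \<Rightarrow> nat \<Rightarrow> real \<Rightarrow> ennreal" where
  "convol_power g 0 = g"
| "convol_power g (Suc n) = convol g (convol_power g n)"

lemma borel_measurable_convol_power [measurable]:
  assumes [measurable]: "g \<in> borel_measurable borel"
  shows "convol_power g n \<in> borel_measurable borel"
  by (induction n) simp_all

lemma nn_integral_convol_power:
  assumes [measurable]: "g \<in> borel_measurable borel" and "(\<integral>\<^sup>+x. g x \<partial>lborel) = 1"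
  shows "(\<integral>\<^sup>+x. convol_power g n x \<partial>lborel) = 1"
proof (induction n)
  case (Suc n)
  then show ?case
    using nn_integral_convol[of g "convol_power g n" "\<lambda>_. 1"] assms by simp
qed (use assms in simp)

lemma convol_power_nonpos:
  assumes "\<And>x. x \<le> 0 \<Longrightarrow> g x = 0" "x \<le> 0"
  shows "convol_power g n x = 0"
  using assms(2)
proof (induction n arbitrary: x)
  case (Suc n)
  have *: "g y * convol_power g n (x - y) = 0" for y
    using Suc assms(1)[of y] by (cases "y \<le> 0") auto
  show ?case
    unfolding convol_power.simps convol_def * by simp
qed (use assms in simp)

text \<open>
  If \<open>n + 2\<close> summands add up to \<open>x\<close>, then the first one is at least \<open>x / (n + 2)\<close> or the others add
  up to at least \<open>x (n + 1) / (n + 2)\<close>.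
\<close>

lemma convol_power_le:
  assumes [measurable]: "g \<in> borel_measurable borel"
    and one: "(\<integral>\<^sup>+x. g x \<partial>lborel) = 1"
    and bound: "\<And>x. x > 0 \<Longrightarrow> g x \<le> ennreal (L * (1 + 1 / x))"
    and "x > 0" "L \<ge> 0"
  shows "convol_power g n x \<le> ennreal (real (Suc n) * L * (1 + real (Suc n) / x))"
  using \<open>x > 0\<close>
proof (induction n arbitrary: x)
  case 0
  then show ?case
    using bound[of x] by simp
next
  case (Suc n)
  define N where "N = real (Suc n)"
  have N: "N > 0"
    by (simp add: N_def)
  \<comment> \<open>\<open>B\<close> is the bound for \<open>g\<close> at
    \<open>x / (N + 1)\<close>. The induction hypothesis at \<open>x * N / (N + 1)\<close> evaluates
    to exactly \<open>N * B\<close>, so that the two cases add up to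
    \<open>(N + 1) * B\<close>.\<close>
  define B where "B = L * (1 + (N + 1) / x)"
  have B: "B \<ge> 0"
    using \<open>L \<ge> 0\<close> N Suc.prems by (simp add: B_def)
  have "g y * convol_power g n (x - y) \<le> ennreal B * convol_power g n (x - y) + ennreal (N * B) * g y"
    for y
  proof (cases "y \<ge> x / (N + 1)")
    case True
    have y: "y > 0"
      using True Suc.prems N by (meson add_pos_pos divide_pos_pos less_le_trans zero_less_one)
    have "1 / y \<le> (N + 1) / x"
      using True Suc.prems N y by (simp add: field_simps)
    then have "L * (1 + 1 / y) \<le> B"
      unfolding B_def using \<open>L \<ge> 0\<close> by (intro mult_left_mono) auto
    then have "g y \<le> ennreal B"
      using bound[OF y] by (meson ennreal_leI order_trans)
    then have "g y * convol_power g n (x - y) \<le> ennreal B * convol_power g n (x - y)"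
      by (intro mult_right_mono) auto
    then show ?thesis
      by (intro add_increasing2) auto
  next
    case False
    then have y: "x - y \<ge> x * N / (N + 1)"
      using N by (simp add: field_simps)
    moreover have "x * N / (N + 1) > 0"
      using Suc.prems N by simp
    ultimately have pos: "x - y > 0"
      by linarith
    have "N / (x - y) \<le> (N + 1) / x"
      using y pos N Suc.prems by (simp add: field_simps)
    then have "N * L * (1 + N / (x - y)) \<le> N * B"
      unfolding B_def using \<open>L \<ge> 0\<close> N by (simp add: mult_left_mono)
    then have "convol_power g n (x - y) \<le> ennreal (N * B)"
      using Suc.IH[OF pos] unfolding N_def by (meson ennreal_leI order_trans)
    then have "g y * convol_power g n (x - y) \<le> ennreal (N * B) * g y"
      by (subst mult.commute) (intro mult_right_mono, auto)
    then show ?thesis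
      by (intro add_increasing) auto
  qed
  then have "convol_power g (Suc n) x \<le>
      (\<integral>\<^sup>+y. ennreal B * convol_power g n (x - y) + ennreal (N * B) * g y \<partial>lborel)"
    by (simp add: convol_def nn_integral_mono)
  also have "\<dots> = ennreal B * (\<integral>\<^sup>+y. convol_power g n (x - y) \<partial>lborel) + ennreal (N * B)"
    using one by (simp add: nn_integral_add nn_integral_cmult)
  also have "(\<integral>\<^sup>+y. convol_power g n (x - y) \<partial>lborel) = (\<integral>\<^sup>+y. convol_power g n y \<partial>lborel)"
    by (subst (2) nn_integral_real_affine[where c = "-1" and t = x]) auto
  also have "\<dots> = 1"
    using one by (rule nn_integral_convol_power[rotated]) simp
  also have "ennreal B * 1 + ennreal (N * B) = ennreal (B + N * B)"
    using B N by (simp add: ennreal_plus)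
  also have "B + N * B = real (Suc (Suc n)) * L * (1 + real (Suc (Suc n)) / x)"
  proof -
    have "real (Suc (Suc n)) = N + 1"
      by (simp add: N_def)
    then show ?thesis
      by (simp only: B_def) (simp add: distrib_right)
  qed
  finally show ?case .
qed

text \<open>The weight is the probability of exactly \<open>n + 1\<close> summands, in step with the
  shifted index of \<open>convol_power\<close>.\<close>

definition geometric_sum_density :: "(real \<Rightarrow> ennreal) \<Rightarrow> real \<Rightarrow> ennreal" where
  "geometric_sum_density g x = (\<Sum>n. ennreal ((1 / 2) ^ Suc n) * convol_power g n x)"

lemma borel_measurable_geometric_sum_density [measurable]:
  assumes [measurable]: "g \<in> borel_measurable borel"
  shows "geometric_sum_density g \<in> borel_measurable borel"
  unfolding geometric_sum_density_def by measurable

text \<open>Split off the first summand: with probability 1/2 the sum ends there, otherwise an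
  independent geometric sum follows. The factor 2 clears both probabilities.\<close>

lemma geometric_sum_density_renewal:
  assumes [measurable]: "g \<in> borel_measurable borel"
  shows "2 * geometric_sum_density g x = g x + convol g (geometric_sum_density g) x"
proof -
  have two: "2 * (ennreal ((1 / 2) ^ Suc n) * y) = ennreal ((1 / 2) ^ n) * y" for n y
  proof -
    have "2 * ennreal ((1 / 2) ^ Suc n) = ennreal (2 * (1 / 2) ^ Suc n)"
      by (subst ennreal_mult) auto
    then show ?thesis
      by (simp add: mult.assoc[symmetric])
  qed
  have "2 * geometric_sum_density g x = (\<Sum>n. ennreal ((1 / 2) ^ n) * convol_power g n x)"
    unfolding geometric_sum_density_def ennreal_suminf_cmult[symmetric] two ..
  also have "\<dots> = (\<Sum>n. ennreal ((1 / 2) ^ Suc n) * convol_power g (Suc n) x) + g x"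
    by (subst suminf_offset[of _ 1]) auto
  also have "(\<Sum>n. ennreal ((1 / 2) ^ Suc n) * convol_power g (Suc n) x) =
      convol g (geometric_sum_density g) x"
  proof -
    have "(\<Sum>n. ennreal ((1 / 2) ^ Suc n) * convol_power g (Suc n) x) =
        (\<Sum>n. \<integral>\<^sup>+y. ennreal ((1 / 2) ^ Suc n) * (g y * convol_power g n (x - y)) \<partial>lborel)"
      by (simp add: convol_def nn_integral_cmult)
    also have "\<dots> =
        (\<integral>\<^sup>+y. (\<Sum>n. ennreal ((1 / 2) ^ Suc n) * (g y * convol_power g n (x - y))) \<partial>lborel)"
      by (intro nn_integral_suminf[symmetric]) measurable
    also have "\<dots> = convol g (geometric_sum_density g) x"
      unfolding convol_def geometric_sum_density_def ennreal_suminf_cmult[symmetric]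
      by (simp add: mult_ac)
    finally show ?thesis .
  qed
  finally show ?thesis
    by (simp add: add.commute)
qed

lemma nn_integral_geometric_sum_density:
  assumes [measurable]: "g \<in> borel_measurable borel" "h \<in> borel_measurable borel"
  shows "(\<integral>\<^sup>+x. geometric_sum_density g x * h x \<partial>lborel) =
    (\<Sum>n. ennreal ((1 / 2) ^ Suc n) * (\<integral>\<^sup>+x. convol_power g n x * h x \<partial>lborel))"
proof -
  have "(\<integral>\<^sup>+x. geometric_sum_density g x * h x \<partial>lborel) =
      (\<integral>\<^sup>+x. (\<Sum>n. ennreal ((1 / 2) ^ Suc n) * (convol_power g n x * h x)) \<partial>lborel)"
    unfolding geometric_sum_density_def ennreal_suminf_multc[symmetric] by (simp add: mult.assoc)
  also have "\<dots> = (\<Sum>n. \<integral>\<^sup>+x. ennreal ((1 / 2) ^ Suc n) * (convol_power g n x * h x) \<partial>lborel)"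
    by (intro nn_integral_suminf) measurable
  finally show ?thesis
    by (simp add: nn_integral_cmult)
qed

lemma suminf_half_powers: "(\<Sum>n. ennreal ((1 / 2) ^ Suc n)) = 1"
  unfolding ennreal_1[symmetric] by (rule suminf_ennreal_eq[OF _ power_half_series]) simp

text \<open>The constants for the convolution powers grow only quadratically in the number of
  summands, so their sum against the weights \<open>(1 / 2) ^ Suc n\<close> is finite.\<close>

lemma geometric_sum_density_bounded:
  assumes [measurable]: "g \<in> borel_measurable borel"
    and one: "(\<integral>\<^sup>+x. g x \<partial>lborel) = 1"
    and bound: "\<And>x. x > 0 \<Longrightarrow> g x \<le> ennreal (L * (1 + 1 / x))" and L: "L \<ge> 0"
  shows "\<exists>K. \<forall>x>0. geometric_sum_density g x \<le> ennreal (K * (1 + 1 / x))"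
proof -
  define k where "k n = (1 / 2) ^ Suc n * (real (Suc n))\<^sup>2 * L" for n
  have "summable (\<lambda>n. (1 / 2 :: real) ^ Suc n * (real (Suc n))\<^sup>2)"
  proof -
    have "summable (\<lambda>n. (real n)\<^sup>2 * (1 / 2 :: real) ^ n)"
    \<comment> \<open>From 3 on, \<open>n + 1\<close> is at most 4/3 of \<open>n\<close>, and
      (4/3)^2 / 2 = 8/9.\<close>
    proof (rule summable_ratio_test[where c = "8 / 9" and N = 3])
      fix n :: nat
      assume "3 \<le> n"
      then have "(real n + 1)\<^sup>2 \<le> (4 / 3 * real n)\<^sup>2"
        by (intro power_mono) auto
      then have "(real (Suc n))\<^sup>2 / 2 \<le> 8 / 9 * (real n)\<^sup>2"
        by (simp add: power_mult_distrib power_divide add.commute)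
      from mult_right_mono[OF this, of "(1 / 2) ^ n"]
      have "(real (Suc n))\<^sup>2 / 2 * (1 / 2) ^ n \<le> 8 / 9 * (real n)\<^sup>2 * (1 / 2) ^ n"
        by simp
      then show "norm ((real (Suc n))\<^sup>2 * (1 / 2) ^ Suc n) \<le> 8 / 9 * norm ((real n)\<^sup>2 * (1 / 2 :: real) ^ n)"
        by (simp only: real_norm_def abs_mult abs_power2 power_Suc) simp
    qed simp
    then show ?thesis
      by (subst (asm) summable_Suc_iff[symmetric]) (simp add: mult.commute)
  qed
  then have k: "summable k"
    unfolding k_def by (rule summable_mult2)
  have "geometric_sum_density g x \<le> ennreal (suminf k * (1 + 1 / x))" if x: "x > 0" for x
  proof -
    have "ennreal ((1 / 2) ^ Suc n) * convol_power g n x \<le> ennreal (k n * (1 + 1 / x))" for n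
    proof -
      have "real (Suc n) * L * (1 + real (Suc n) / x) \<le>
          real (Suc n) * L * (real (Suc n) + real (Suc n) / x)"
        using L by (intro mult_left_mono) auto
      also have "\<dots> = (real (Suc n))\<^sup>2 * L * (1 + 1 / x)"
        by (simp only: power2_eq_square) (simp only: algebra_simps times_divide_eq_right mult_1_right)
      finally have "convol_power g n x \<le> ennreal ((real (Suc n))\<^sup>2 * L * (1 + 1 / x))"
        by (intro order_trans[OF convol_power_le[OF assms(1) one bound x L]] ennreal_leI)
      then have "ennreal ((1 / 2) ^ Suc n) * convol_power g n x \<le>
          ennreal ((1 / 2) ^ Suc n) * ennreal ((real (Suc n))\<^sup>2 * L * (1 + 1 / x))"
        by (rule mult_left_mono) simp
      also have "\<dots> = ennreal (k n * (1 + 1 / x))"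
        using L x unfolding k_def by (subst ennreal_mult[symmetric]) (simp_all add: mult.assoc)
      finally show ?thesis .
    qed
    then have "geometric_sum_density g x \<le> (\<Sum>n. ennreal (k n * (1 + 1 / x)))"
      unfolding geometric_sum_density_def by (intro suminf_le) auto
    also have "\<dots> = ennreal (\<Sum>n. k n * (1 + 1 / x))"
      using x L by (intro suminf_ennreal2 summable_mult2[OF k]) (auto simp: k_def)
    finally show ?thesis
      by (simp add: suminf_mult2[OF k])
  qed
  then show ?thesis
    by blast
qed

text \<open>An i.i.d. sequence is its first member followed by an independent copy of the whole
  sequence, as expressed by \<open>PiM_iter\<close>.\<close>

lemma nn_integral_PiM_sum_Suc:
  fixes N :: "real measure"
  assumes "prob_space N" and sets [measurable_cong]: "sets N = sets borel"
    and [measurable]: "h \<in> borel_measurable borel"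
  shows "(\<integral>\<^sup>+\<omega>. h (\<Sum>k<Suc n. \<omega> k) \<partial>(\<Pi>\<^sub>M k\<in>(UNIV :: nat set). N)) =
    (\<integral>\<^sup>+x. \<integral>\<^sup>+\<omega>. h (x + (\<Sum>k<n. \<omega> k)) \<partial>(\<Pi>\<^sub>M k\<in>(UNIV :: nat set). N) \<partial>N)"
proof -
  interpret prob_space N by fact
  interpret sequence_space N ..
  have "(\<integral>\<^sup>+\<omega>. h (\<Sum>k<Suc n. \<omega> k) \<partial>S) =
      (\<integral>\<^sup>+\<omega>. h (\<Sum>k<Suc n. \<omega> k) \<partial>distr (N \<Otimes>\<^sub>M S) S (\<lambda>(s, \<omega>). case_nat s \<omega>))"
    by (simp only: PiM_iter)
  also have "\<dots> = (\<integral>\<^sup>+(x, \<omega>). h (x + (\<Sum>k<n. \<omega> k)) \<partial>(N \<Otimes>\<^sub>M S))"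
    by (subst nn_integral_distr)
      (auto simp: sum.lessThan_Suc_shift case_prod_beta' simp del: sum.lessThan_Suc)
  also have "\<dots> = (\<integral>\<^sup>+x. \<integral>\<^sup>+\<omega>. h (x + (\<Sum>k<n. \<omega> k)) \<partial>S \<partial>N)"
    by (subst P.nn_integral_fst[symmetric]) auto
  finally show ?thesis .
qed

text \<open>The induction splits off the first summand and shifts the test function by it, hence the
  generalization over \<open>h\<close>.\<close>

lemma nn_integral_PiM_sum_density:
  assumes [measurable]: "g \<in> borel_measurable borel" "h \<in> borel_measurable borel"
    and one: "(\<integral>\<^sup>+x. g x \<partial>lborel) = 1"
  shows "(\<integral>\<^sup>+\<omega>. h (\<Sum>k<Suc n. \<omega> k) \<partial>(\<Pi>\<^sub>M k\<in>(UNIV :: nat set). density lborel g)) =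
    (\<integral>\<^sup>+x. convol_power g n x * h x \<partial>lborel)"
  using assms(2)
proof (induction n arbitrary: h)
  have prob: "prob_space (density lborel g)"
    using one by (intro prob_spaceI) (simp add: emeasure_density)
  then interpret prob_space "\<Pi>\<^sub>M k\<in>(UNIV :: nat set). density lborel g"
    by (intro prob_space_PiM)
  {
    case 0
    note [measurable] = 0
    show ?case
      by (subst nn_integral_PiM_sum_Suc[OF prob])
        (simp_all add: nn_integral_density emeasure_space_1)
  next
    case (Suc n)
    note [measurable] = Suc.prems
    have "(\<integral>\<^sup>+\<omega>. h (\<Sum>k<Suc (Suc n). \<omega> k) \<partial>(\<Pi>\<^sub>M k\<in>(UNIV :: nat set). density lborel g)) =
        (\<integral>\<^sup>+x. \<integral>\<^sup>+y. convol_power g n y * h (x + y) \<partial>lborel \<partial>density lborel g)"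
    proof -
      have "(\<integral>\<^sup>+\<omega>. h (x + (\<Sum>k<Suc n. \<omega> k)) \<partial>(\<Pi>\<^sub>M k\<in>(UNIV :: nat set). density lborel g)) =
          (\<integral>\<^sup>+y. convol_power g n y * h (x + y) \<partial>lborel)" for x
        by (rule Suc.IH) simp
      then show ?thesis
        by (subst nn_integral_PiM_sum_Suc[OF prob]) (simp_all del: sum.lessThan_Suc)
    qed
    also have "\<dots> = (\<integral>\<^sup>+x. convol_power g (Suc n) x * h x \<partial>lborel)"
      by (simp add: nn_integral_convol nn_integral_density)
    finally show ?case .
  }
qed

lemma density_geometric_sum_in_GD_2:
  assumes [measurable]: "g \<in> borel_measurable borel"
    and one: "(\<integral>\<^sup>+x. g x \<partial>lborel) = 1" and zero: "\<And>x. x \<le> 0 \<Longrightarrow> g x = 0"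
  shows "density lborel (geometric_sum_density g) \<in> GD 2"
proof -
  define G where "G = density lborel g"
  have prob: "prob_space G"
    using one by (intro prob_spaceI) (simp add: G_def emeasure_density)
  have sets_G [measurable_cong]: "sets G = sets borel"
    by (simp add: G_def)
  have "AE x in lborel. g x > 0 \<longrightarrow> 0 \<le> x"
    using zero by (intro AE_I2) (metis linear less_irrefl)
  then have pos: "AE x in G. 0 \<le> x"
    unfolding G_def by (subst AE_density) simp_all
  let ?S = "\<Pi>\<^sub>M k\<in>(UNIV :: nat set). G"
  let ?P = "measure_pmf (map_pmf Suc (geometric_pmf (1 / 2)))"
  interpret S: prob_space ?S
    using prob by (intro prob_space_PiM)
  \<comment> \<open>The number of summands is random but takes countably many values, so
    measurability is checked for each value separately.\<close>
  have meas [measurable]: "(\<lambda>(\<nu>, w). \<Sum>k<\<nu>. w k) \<in> borel_measurable (?P \<Otimes>\<^sub>M ?S)"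
  proof -
    have "(\<lambda>(\<nu>, w). \<Sum>k<\<nu>. w k) \<in> borel_measurable (count_space UNIV \<Otimes>\<^sub>M ?S)"
      by (rule measurable_pair_measure_countable1) auto
    then show ?thesis
      by (simp cong: measurable_cong_sets add: sets_pair_measure_cong)
  qed
  have "distr (?P \<Otimes>\<^sub>M ?S) borel (\<lambda>(\<nu>, w). \<Sum>k<\<nu>. w k) = density lborel (geometric_sum_density g)"
  proof (rule measure_eqI)
    fix E
    assume "E \<in> sets (distr (?P \<Otimes>\<^sub>M ?S) borel (\<lambda>(\<nu>, w). \<Sum>k<\<nu>. w k))"
    then have [measurable]: "E \<in> sets borel"
      by simp
    have "emeasure (distr (?P \<Otimes>\<^sub>M ?S) borel (\<lambda>(\<nu>, w). \<Sum>k<\<nu>. w k)) E =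
        (\<integral>\<^sup>+x. indicator E x \<partial>distr (?P \<Otimes>\<^sub>M ?S) borel (\<lambda>(\<nu>, w). \<Sum>k<\<nu>. w k))"
      by simp
    also have "\<dots> = (\<integral>\<^sup>+(\<nu>, w). indicator E (\<Sum>k<\<nu>. w k) \<partial>(?P \<Otimes>\<^sub>M ?S))"
      by (subst nn_integral_distr) (auto simp: case_prod_beta')
    also have "\<dots> = (\<integral>\<^sup>+\<nu>. \<integral>\<^sup>+w. indicator E (\<Sum>k<\<nu>. w k) \<partial>?S \<partial>?P)"
    proof -
      have "(\<lambda>(\<nu>, w). indicator E (\<Sum>k<\<nu>. w k) :: ennreal) \<in> borel_measurable (?P \<Otimes>\<^sub>M ?S)"
        using measurable_compose[OF meas, of "indicator E" borel] by (simp add: case_prod_beta')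
      from S.nn_integral_fst[OF this] show ?thesis
        by simp
    qed
    also have "\<dots> = (\<integral>\<^sup>+n. \<integral>\<^sup>+w. indicator E (\<Sum>k<Suc n. w k) \<partial>?S \<partial>geometric_pmf (1 / 2))"
      by simp
    also have "\<dots> = (\<integral>\<^sup>+n. \<integral>\<^sup>+x. convol_power g n x * indicator E x \<partial>lborel \<partial>geometric_pmf (1 / 2))"
      unfolding G_def by (subst nn_integral_PiM_sum_density) (simp_all add: one)
    also have "\<dots> = (\<integral>\<^sup>+x. geometric_sum_density g x * indicator E x \<partial>lborel)"
      by (subst nn_integral_geometric_sum_density)
        (simp_all add: nn_integral_measure_pmf nn_integral_count_space_nat mult.commute)
    finally show "emeasure (distr (?P \<Otimes>\<^sub>M ?S) borel (\<lambda>(\<nu>, w). \<Sum>k<\<nu>. w k)) E =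
        emeasure (density lborel (geometric_sum_density g)) E"
      by (simp add: emeasure_density)
  qed simp
  then show ?thesis
    using prob sets_G pos unfolding GD_def by (auto intro!: exI[of _ G])
qed

section \<open>The mean of the switch process\<close>

lemma borel_measurable_switch_process [measurable (raw)]:
  assumes [measurable]: "\<And>k. (\<lambda>x. X x k) \<in> borel_measurable M" "U \<in> borel_measurable M"
  shows "(\<lambda>x. switch_process (X x) (U x)) \<in> borel_measurable M"
proof -
  have "(\<lambda>x. switch_count (X x) (U x)) \<in> M \<rightarrow>\<^sub>M count_space UNIV"
    unfolding switch_count_def by measurable
  then show ?thesis
    unfolding switch_process_def by measurable
qed

text \<open>
  The bound also covers the junk value of \<open>switch_count\<close> when infinitely many switches take place
  up to time \<open>u\<close>, because then \<open>s N = 1\<close>.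
\<close>

lemma switch_process_expansion:
  fixes T :: "nat \<Rightarrow> real" and u :: real
  assumes T: "\<And>k. 0 \<le> T k"
  defines "s \<equiv> \<lambda>n. indicator {..u} (\<Sum>k<n. T k)"
  assumes "0 \<le> u"
  shows "\<bar>switch_process T u - (\<Sum>n<N. (- 1) ^ n * (s n - s (Suc n)))\<bar> \<le> (s N :: real)"
proof -
  have mono: "(\<Sum>k<m. T k) \<le> (\<Sum>k<n. T k)" if "m \<le> n" for m n
    using that T by (intro sum_mono2) auto
  have s: "s n = (if (\<Sum>k<n. T k) \<le> u then 1 else 0)" for n
    by (simp add: s_def indicator_def)
  show ?thesis
  proof (cases "(\<Sum>k<N. T k) \<le> u")
    case True
    then have "s n = 1" if "n \<le> N" for n
      using mono[OF that] by (simp add: s)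
    then have "(\<Sum>n<N. (- 1) ^ n * (s n - s (Suc n))) = 0"
      by (intro sum.neutral) auto
    then show ?thesis
      using True by (simp add: s switch_process_def power_abs)
  next
    case False
    define m where "m = switch_count T u"
    have bounded: "n < N" if "(\<Sum>k<n. T k) \<le> u" for n
      using False mono[of N n] that by (meson linorder_not_le order_trans)
    then have fin: "finite {n. (\<Sum>k<n. T k) \<le> u}"
      by (metis (no_types, lifting) bounded_nat_set_is_finite mem_Collect_eq)
    have "0 \<in> {n. (\<Sum>k<n. T k) \<le> u}"
      using \<open>0 \<le> u\<close> by simp
    then have ne: "{n. (\<Sum>k<n. T k) \<le> u} \<noteq> {}"
      by blast
    with fin have m: "m = Max {n. (\<Sum>k<n. T k) \<le> u}"
      unfolding m_def switch_count_def Sup_nat_def by presburger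
    have m_in: "(\<Sum>k<m. T k) \<le> u"
      using Max_in[OF fin ne] m by simp
    have *: "(\<Sum>k<n. T k) \<le> u \<longleftrightarrow> n \<le> m" for n
      using Max_ge[OF fin, of n] m m_in mono[of n m] by (metis mem_Collect_eq order_trans)
    \<comment> \<open>\<open>s n - s (Suc n)\<close> indicates that the number of switches up to
      \<open>u\<close> is exactly \<open>n\<close>, which singles out the term with
      \<open>n = m\<close>.\<close>
    have "(\<Sum>n<N. (- 1) ^ n * (s n - s (Suc n))) = (\<Sum>n<N. if n = m then (- 1) ^ m else 0)"
      by (intro sum.cong) (auto simp: s * not_less_eq_eq simp del: sum.lessThan_Suc)
    also have "\<dots> = (- 1) ^ m"
      using bounded[OF m_in] by simp
    finally show ?thesis
      by (simp add: switch_process_def m_def[symmetric] s)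
  qed
qed

section \<open>Tails and the renewal equation\<close>

definition cdf_of :: "(real \<Rightarrow> ennreal) \<Rightarrow> real \<Rightarrow> ennreal" where
  "cdf_of g u = (\<integral>\<^sup>+x. g x * indicator {..u} x \<partial>lborel)"

text \<open>Set to 0 on the negative half-line, so that the integral over the whole line is the mean
  and convolutions with the tail need no explicit range.\<close>

definition tail_of :: "(real \<Rightarrow> ennreal) \<Rightarrow> real \<Rightarrow> ennreal" where
  "tail_of g u = (if 0 \<le> u then \<integral>\<^sup>+x. g x * indicator {u<..} x \<partial>lborel else 0)"

lemma borel_measurable_cdf_of [measurable]:
  assumes [measurable]: "g \<in> borel_measurable borel"
  shows "cdf_of g \<in> borel_measurable borel"
proof -
  have "(\<lambda>u. \<integral>\<^sup>+x. (if x \<le> u then g x else 0) \<partial>lborel) \<in> borel_measurable borel"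
    by measurable
  also have "(\<lambda>u. \<integral>\<^sup>+x. (if x \<le> u then g x else 0) \<partial>lborel) = cdf_of g"
    unfolding cdf_of_def by (intro ext nn_integral_cong) auto
  finally show ?thesis .
qed

lemma borel_measurable_tail_of [measurable]:
  assumes [measurable]: "g \<in> borel_measurable borel"
  shows "tail_of g \<in> borel_measurable borel"
proof -
  have "(\<lambda>u. if 0 \<le> u then \<integral>\<^sup>+x. (if u < x then g x else 0) \<partial>lborel else 0) \<in> borel_measurable borel"
    by measurable
  also have "(\<lambda>u. if 0 \<le> u then \<integral>\<^sup>+x. (if u < x then g x else 0) \<partial>lborel else 0) = tail_of g"
    unfolding tail_of_def by (intro ext if_cong nn_integral_cong) auto
  finally show ?thesis .
qed

lemma nn_integral_tail_of:
  assumes [measurable]: "g \<in> borel_measurable borel" and zero: "\<And>x. x \<le> 0 \<Longrightarrow> g x = 0"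
  shows "(\<integral>\<^sup>+u. tail_of g u \<partial>lborel) = (\<integral>\<^sup>+x. ennreal x * g x \<partial>lborel)"
proof -
  have "(\<integral>\<^sup>+u. tail_of g u \<partial>lborel) =
      (\<integral>\<^sup>+u. \<integral>\<^sup>+x. (if 0 \<le> u \<and> u < x then g x else 0) \<partial>lborel \<partial>lborel)"
    unfolding tail_of_def by (auto intro!: nn_integral_cong)
  also have "\<dots> = (\<integral>\<^sup>+x. \<integral>\<^sup>+u. (if 0 \<le> u \<and> u < x then g x else 0) \<partial>lborel \<partial>lborel)"
    by (subst lborel_pair.Fubini') auto
  also have "\<dots> = (\<integral>\<^sup>+x. ennreal x * g x \<partial>lborel)"
  proof (intro nn_integral_cong)
    fix x :: real
    have "(\<integral>\<^sup>+u. (if 0 \<le> u \<and> u < x then g x else 0) \<partial>lborel) =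
        (\<integral>\<^sup>+u. g x * indicator {0..<x} u \<partial>lborel)"
      by (intro nn_integral_cong) auto
    also have "\<dots> = ennreal x * g x"
      using zero[of x] by (cases "x \<le> 0") (simp_all add: nn_integral_cmult_indicator mult.commute)
    finally show "(\<integral>\<^sup>+u. (if 0 \<le> u \<and> u < x then g x else 0) \<partial>lborel) = ennreal x * g x" .
  qed
  finally show ?thesis .
qed

text \<open>Everything that is required of the summand law. Finiteness of its mean is stated through
  the tail because in the application the tail is - c' / D, whose integral is computed
  directly.\<close>

locale thinned_renewal =
  fixes g :: "real \<Rightarrow> ennreal" and L :: real
  assumes borel [measurable]: "g \<in> borel_measurable borel"
    and zero: "\<And>x. x \<le> 0 \<Longrightarrow> g x = 0"
    and one: "(\<integral>\<^sup>+x. g x \<partial>lborel) = 1"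
    and bound: "\<And>x. x > 0 \<Longrightarrow> g x \<le> ennreal (L * (1 + 1 / x))" and L: "L \<ge> 0"
    and mean: "(\<integral>\<^sup>+u. tail_of g u \<partial>lborel) < \<infinity>"
begin

abbreviation \<phi> :: "real \<Rightarrow> ennreal" where
  "\<phi> \<equiv> geometric_sum_density g"

definition f :: "real \<Rightarrow> real" where
  "f x = enn2real (\<phi> x)"

lemma \<phi>_nonpos: "x \<le> 0 \<Longrightarrow> \<phi> x = 0"
  using convol_power_nonpos[of g x, OF zero] by (simp add: geometric_sum_density_def)

lemma \<phi>_bounded: "\<exists>K. \<forall>x>0. \<phi> x \<le> ennreal (K * (1 + 1 / x))"
  by (rule geometric_sum_density_bounded[OF borel one bound L])

text \<open>The bound makes \<open>\<phi>\<close> finite at every point, so the passage to real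
  values never meets the default value of \<open>enn2real\<close> at infinity.\<close>

lemma ennreal_f: "ennreal (f x) = \<phi> x"
proof -
  obtain K where "\<forall>x>0. \<phi> x \<le> ennreal (K * (1 + 1 / x))"
    using \<phi>_bounded by blast
  then have "\<phi> x < top"
    using \<phi>_nonpos[of x] by (cases "x \<le> 0") (simp, meson ennreal_less_top le_less_trans not_le)
  then show ?thesis
    by (simp add: f_def)
qed

lemma borel_measurable_f [measurable]: "f \<in> borel_measurable borel"
  unfolding f_def by measurable

lemma f_nonneg: "0 \<le> f x"
  by (simp add: f_def)

lemma mult_f_nonneg: "0 \<le> x * f x"
  using \<phi>_nonpos[of x] f_nonneg[of x] by (cases "x \<le> 0") (auto simp: f_def)

lemma ennreal_mult_f: "ennreal (x * f x) = ennreal x * \<phi> x"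
  using \<phi>_nonpos[of x] f_nonneg[of x] ennreal_f[of x]
  by (cases "x \<le> 0") (auto simp: f_def ennreal_mult)

lemma \<phi>_one: "(\<integral>\<^sup>+x. \<phi> x \<partial>lborel) = 1"
  using nn_integral_geometric_sum_density[of g "\<lambda>_. 1"]
  by (simp only: mult_1_right nn_integral_convol_power[OF borel one] suminf_half_powers
      borel borel_measurable_const)

abbreviation F :: "real measure" where
  "F \<equiv> density lborel \<phi>"

lemma switching_dist_f: "switching_dist f = F"
  unfolding switching_dist_def by (simp add: ennreal_f)

lemma prob_space_F: "prob_space F"
  using \<phi>_one by (intro prob_spaceI) (simp add: emeasure_density)

lemma switching_dist_in_GD: "switching_dist f \<in> GD 2"
  unfolding switching_dist_f by (rule density_geometric_sum_in_GD_2[OF borel one zero])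

text \<open>The renewal identity tested against \<open>h\<close>. With W of density \<open>g\<close>
  and T of density \<open>\<phi>\<close> independent, a switching time is a fair mixture of W and W
  + T.\<close>

lemma nn_integral_\<phi>_renewal:
  assumes [measurable]: "h \<in> borel_measurable borel"
  shows "2 * (\<integral>\<^sup>+x. \<phi> x * h x \<partial>lborel) =
    (\<integral>\<^sup>+x. g x * h x \<partial>lborel) + (\<integral>\<^sup>+z. g z * (\<integral>\<^sup>+y. \<phi> y * h (z + y) \<partial>lborel) \<partial>lborel)"
proof -
  have "2 * (\<integral>\<^sup>+x. \<phi> x * h x \<partial>lborel) = (\<integral>\<^sup>+x. 2 * \<phi> x * h x \<partial>lborel)"
    by (simp add: nn_integral_cmult mult.assoc)
  also have "\<dots> = (\<integral>\<^sup>+x. g x * h x + convol g \<phi> x * h x \<partial>lborel)"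
    by (simp add: geometric_sum_density_renewal distrib_right)
  also have "\<dots> = (\<integral>\<^sup>+x. g x * h x \<partial>lborel) + (\<integral>\<^sup>+x. convol g \<phi> x * h x \<partial>lborel)"
    by (intro nn_integral_add) measurable
  finally show ?thesis
    by (simp add: nn_integral_convol)
qed

text \<open>One copy of the tail of \<open>g\<close> belongs to sums with the single summand W, the
  other to longer sums in which already W exceeds \<open>u\<close>. The convolution covers the
  longer sums in which W is at most \<open>u\<close> and the rest exceeds
  \<open>u - W\<close>.\<close>

lemma tail_renewal: "2 * tail_of \<phi> u = 2 * tail_of g u + convol g (tail_of \<phi>) u"
proof (cases "0 \<le> u")
  case True
  have "(\<integral>\<^sup>+y. \<phi> y * indicator {u<..} (z + y) \<partial>lborel) = indicator {u<..} z + tail_of \<phi> (u - z)" for z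
  proof (cases "z \<le> u")
    case True
    then have "(\<integral>\<^sup>+y. \<phi> y * indicator {u<..} (z + y) \<partial>lborel) = tail_of \<phi> (u - z)"
      unfolding tail_of_def by (auto intro!: nn_integral_cong split: split_indicator)
    then show ?thesis
      using True by simp
  next
    case False
    then have "\<phi> y * indicator {u<..} (z + y) = \<phi> y" for y
      using \<phi>_nonpos[of y] by (cases "y \<le> 0") auto
    then show ?thesis
      using False \<phi>_one by (simp add: tail_of_def)
  qed
  then have "2 * tail_of \<phi> u =
      tail_of g u + (\<integral>\<^sup>+z. g z * (indicator {u<..} z + tail_of \<phi> (u - z)) \<partial>lborel)"
    using True nn_integral_\<phi>_renewal[of "indicator {u<..}"] by (simp add: tail_of_def)
  also have "(\<integral>\<^sup>+z. g z * (indicator {u<..} z + tail_of \<phi> (u - z)) \<partial>lborel) =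
      tail_of g u + convol g (tail_of \<phi>) u"
    using True by (simp add: distrib_left nn_integral_add convol_def tail_of_def[of g])
  finally show ?thesis
    by (simp add: mult_2 add.assoc)
next
  case False
  then have "g z * tail_of \<phi> (u - z) = 0" for z
    using zero[of z] by (cases "z \<le> 0") (auto simp: tail_of_def)
  then have "convol g (tail_of \<phi>) u = 0"
    unfolding convol_def by (simp only: nn_integral_const) simp
  then show ?thesis
    using False by (simp add: tail_of_def)
qed

text \<open>Used with \<open>h = 1\<close> for the mean and with the indicator of
  \<open>{..t}\<close> for the truncated mean that enters the covariance.\<close>

lemma nn_integral_tail_renewal:
  assumes [measurable]: "h \<in> borel_measurable borel"
  shows "2 * (\<integral>\<^sup>+u. tail_of \<phi> u * h u \<partial>lborel) = 2 * (\<integral>\<^sup>+u. tail_of g u * h u \<partial>lborel) +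
    (\<integral>\<^sup>+y. tail_of \<phi> y * (\<integral>\<^sup>+z. g z * h (z + y) \<partial>lborel) \<partial>lborel)"
proof -
  have "2 * (\<integral>\<^sup>+u. tail_of \<phi> u * h u \<partial>lborel) = (\<integral>\<^sup>+u. 2 * tail_of \<phi> u * h u \<partial>lborel)"
    by (simp add: nn_integral_cmult mult.assoc)
  also have "\<dots> = (\<integral>\<^sup>+u. 2 * (tail_of g u * h u) + convol g (tail_of \<phi>) u * h u \<partial>lborel)"
    by (simp add: tail_renewal distrib_right mult.assoc)
  also have "\<dots> = 2 * (\<integral>\<^sup>+u. tail_of g u * h u \<partial>lborel) + (\<integral>\<^sup>+u. convol g (tail_of \<phi>) u * h u \<partial>lborel)"
    by (simp add: nn_integral_add nn_integral_cmult)
  also have "(\<integral>\<^sup>+u. convol g (tail_of \<phi>) u * h u \<partial>lborel) =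
      (\<integral>\<^sup>+z. \<integral>\<^sup>+y. g z * (tail_of \<phi> y * h (z + y)) \<partial>lborel \<partial>lborel)"
    by (simp add: nn_integral_convol nn_integral_cmult)
  also have "\<dots> = (\<integral>\<^sup>+y. \<integral>\<^sup>+z. g z * (tail_of \<phi> y * h (z + y)) \<partial>lborel \<partial>lborel)"
    by (subst lborel_pair.Fubini') auto
  also have "\<dots> = (\<integral>\<^sup>+y. tail_of \<phi> y * (\<integral>\<^sup>+z. g z * h (z + y) \<partial>lborel) \<partial>lborel)"
    by (simp add: nn_integral_cmult[symmetric] mult.left_commute)
  finally show ?thesis .
qed

lemma cdf_of_le_one: "cdf_of g u \<le> 1"
  unfolding cdf_of_def one[symmetric] by (intro nn_integral_mono) (auto split: split_indicator)

lemma cdf_of_neg: "u < 0 \<Longrightarrow> cdf_of g u = 0"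
proof -
  assume "u < 0"
  then have "g x * indicator {..u} x = 0" for x
    using zero[of x] by (cases "x \<le> 0") auto
  then show ?thesis
    unfolding cdf_of_def by (simp only: nn_integral_const) simp
qed

lemma tail_renewal_upto:
  "2 * (\<integral>\<^sup>+u. tail_of \<phi> u * indicator {..t} u \<partial>lborel) =
    2 * (\<integral>\<^sup>+u. tail_of g u * indicator {..t} u \<partial>lborel) +
    (\<integral>\<^sup>+y. tail_of \<phi> y * cdf_of g (t - y) \<partial>lborel)"
proof -
  have "cdf_of g (t - y) = (\<integral>\<^sup>+z. g z * indicator {..t} (z + y) \<partial>lborel)" for y
    unfolding cdf_of_def by (intro nn_integral_cong) (auto split: split_indicator)
  then show ?thesis
    by (simp add: nn_integral_tail_renewal)
qed

lemma tail_le_one: "tail_of \<phi> u \<le> 1"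
proof -
  have "(\<integral>\<^sup>+x. \<phi> x * indicator {u<..} x \<partial>lborel) \<le> (\<integral>\<^sup>+x. \<phi> x \<partial>lborel)"
    by (intro nn_integral_mono) (auto split: split_indicator)
  then show ?thesis
    by (simp add: tail_of_def \<phi>_one)
qed

lemma tail_neg: "u < 0 \<Longrightarrow> tail_of \<phi> u = 0"
  by (simp add: tail_of_def)

lemma nn_integral_tail_upto_finite: "(\<integral>\<^sup>+u. tail_of \<phi> u * indicator {..t} u \<partial>lborel) < \<infinity>"
proof -
  have "(\<integral>\<^sup>+u. tail_of \<phi> u * indicator {..t} u \<partial>lborel) \<le> (\<integral>\<^sup>+u. indicator {0..t} u \<partial>lborel)"
    using tail_le_one by (intro nn_integral_mono) (auto simp: tail_neg split: split_indicator)
  also have "\<dots> < \<infinity>"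
    by (simp add: emeasure_lborel_Icc_eq)
  finally show ?thesis .
qed

lemma tail_cdf_le:
  "tail_of \<phi> y * cdf_of g (t - y) \<le> tail_of \<phi> y * indicator {..t} y"
  using cdf_of_neg[of "t - y"] mult_left_mono[OF cdf_of_le_one[of "t - y"], of "tail_of \<phi> y"]
  by (auto split: split_indicator)

text \<open>The renewal identity on the whole line gives nothing as long as both sides may be
  infinite. Truncated at \<open>t\<close>, the integrals are finite and one copy cancels; the
  resulting bound is uniform in \<open>t\<close>.\<close>

lemma mean_tail_finite: "(\<integral>\<^sup>+u. tail_of \<phi> u \<partial>lborel) < \<infinity>"
proof -
  let ?I = "\<lambda>t. \<integral>\<^sup>+u. tail_of \<phi> u * indicator {..t} u \<partial>lborel"
  have "?I t \<le> 2 * (\<integral>\<^sup>+u. tail_of g u \<partial>lborel)" for t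
  proof -
    have "?I t + ?I t = 2 * (\<integral>\<^sup>+u. tail_of g u * indicator {..t} u \<partial>lborel) +
        (\<integral>\<^sup>+y. tail_of \<phi> y * cdf_of g (t - y) \<partial>lborel)"
      using tail_renewal_upto[of t] by (simp add: mult_2)
    also have "\<dots> \<le> 2 * (\<integral>\<^sup>+u. tail_of g u \<partial>lborel) + ?I t"
      by (intro add_mono mult_left_mono nn_integral_mono tail_cdf_le) (auto split: split_indicator)
    finally show ?thesis
      using nn_integral_tail_upto_finite[of t] by (auto simp: add.commute ennreal_add_left_cancel_le)
  qed
  moreover have "(\<integral>\<^sup>+u. tail_of \<phi> u \<partial>lborel) = (SUP n. ?I (real n))"
  proof -
    have "tail_of \<phi> u = (SUP n. tail_of \<phi> u * indicator {..real n} u)" for u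
    proof (rule antisym)
      obtain n :: nat where "u \<le> real n"
        using real_arch_simple by blast
      then show "tail_of \<phi> u \<le> (SUP n. tail_of \<phi> u * indicator {..real n} u)"
        by (intro SUP_upper2[of n]) auto
    qed (auto intro!: SUP_least split: split_indicator)
    then have "(\<integral>\<^sup>+u. tail_of \<phi> u \<partial>lborel) =
        (\<integral>\<^sup>+u. (SUP n. tail_of \<phi> u * indicator {..real n} u) \<partial>lborel)"
      by simp
    also have "\<dots> = (SUP n. ?I (real n))"
      by (intro nn_integral_monotone_convergence_SUP)
        (auto simp: incseq_def le_fun_def split: split_indicator)
    finally show ?thesis .
  qed
  ultimately have "(\<integral>\<^sup>+u. tail_of \<phi> u \<partial>lborel) \<le> 2 * (\<integral>\<^sup>+u. tail_of g u \<partial>lborel)"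
    by (auto intro: SUP_least)
  also have "\<dots> < \<infinity>"
    using mean by (simp add: ennreal_mult_less_top)
  finally show ?thesis .
qed

text \<open>Wald's identity: the expected number of summands is 2.\<close>

lemma mean_tail: "(\<integral>\<^sup>+u. tail_of \<phi> u \<partial>lborel) = 2 * (\<integral>\<^sup>+u. tail_of g u \<partial>lborel)"
proof -
  let ?I = "\<integral>\<^sup>+u. tail_of \<phi> u \<partial>lborel"
  have "?I + ?I = ?I + 2 * (\<integral>\<^sup>+u. tail_of g u \<partial>lborel)"
    using nn_integral_tail_renewal[of "\<lambda>_. 1"] one by (simp add: mult_2 add.commute)
  then show ?thesis
    using mean_tail_finite by (auto simp: ennreal_add_left_cancel)
qed

lemma switching_density_f: "switching_density f"
proof -
  obtain K where K: "\<And>x. x > 0 \<Longrightarrow> \<phi> x \<le> ennreal (K * (1 + 1 / x))"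
    using \<phi>_bounded by blast
  have "f x \<le> \<bar>K\<bar> * (1 + 1 / a)" if "0 < a" "a \<le> x" for a x
  proof -
    have "K * (1 + 1 / x) \<le> \<bar>K\<bar> * (1 + 1 / a)"
      using that by (intro mult_mono add_mono divide_left_mono) auto
    then have "ennreal (f x) \<le> ennreal (\<bar>K\<bar> * (1 + 1 / a))"
      using K[of x] that unfolding ennreal_f by (meson ennreal_leI less_le_trans order_trans)
    then show ?thesis
      using that by (subst (asm) ennreal_le_iff) auto
  qed
  then have "bdd_above (f ` {a..b})" if "0 < a" for a b
    using that by (intro bdd_aboveI2[of _ _ "\<bar>K\<bar> * (1 + 1 / a)"]) auto
  moreover have "integrable lborel (\<lambda>x. x * f x)"
  proof (rule integrableI_nonneg)
    show "AE x in lborel. 0 \<le> x * f x"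
      by (simp add: mult_f_nonneg)
    have "(\<integral>\<^sup>+x. ennreal (x * f x) \<partial>lborel) = (\<integral>\<^sup>+u. tail_of \<phi> u \<partial>lborel)"
      using \<phi>_nonpos by (simp add: nn_integral_tail_of ennreal_mult_f)
    then show "(\<integral>\<^sup>+x. ennreal (x * f x) \<partial>lborel) < \<infinity>"
      using mean_tail_finite by simp
  qed simp
  moreover have "prob_space (density lborel f)"
    using prob_space_F by (simp add: ennreal_f)
  ultimately show ?thesis
    using \<phi>_nonpos f_nonneg by (auto simp: switching_density_def f_def)
qed

lemma ennreal_switching_mean: "ennreal (switching_mean f) = (\<integral>\<^sup>+u. tail_of \<phi> u \<partial>lborel)"
proof -
  have "(\<integral>\<^sup>+u. tail_of \<phi> u \<partial>lborel) = (\<integral>\<^sup>+x. ennreal (x * f x) \<partial>lborel)"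
    using \<phi>_nonpos by (simp add: nn_integral_tail_of ennreal_mult_f)
  also have "\<dots> = ennreal (\<integral>x. x * f x \<partial>lborel)"
    using switching_density_f mult_f_nonneg
    by (intro nn_integral_eq_integral) (auto simp: switching_density_def)
  also have "(\<integral>x. x * f x \<partial>lborel) = switching_mean f"
    unfolding switching_mean_def switching_dist_def
    by (subst integral_density) (auto simp: f_nonneg mult.commute)
  finally show ?thesis
    by simp
qed

lemma switching_mean_pos: "switching_mean f > 0"
proof (rule ccontr)
  assume "\<not> ?thesis"
  then have "(\<integral>\<^sup>+x. ennreal x * \<phi> x \<partial>lborel) = 0"
    using ennreal_switching_mean nn_integral_tail_of[of \<phi>] \<phi>_nonpos by (simp add: ennreal_neg)
  then have "AE x in lborel. ennreal x * \<phi> x = 0"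
    by (subst (asm) nn_integral_0_iff_AE) auto
  then have "AE x in lborel. \<phi> x = 0"
    by (rule eventually_mono) (use \<phi>_nonpos in \<open>auto simp: ennreal_eq_0_iff\<close>)
  then have "(\<integral>\<^sup>+x. \<phi> x \<partial>lborel) = 0"
    by (subst nn_integral_0_iff_AE) auto
  then show False
    using \<phi>_one by simp
qed

end

section \<open>Partial sums of the switching times and the mean of the switch process\<close>

context thinned_renewal
begin

abbreviation S :: "(nat \<Rightarrow> real) measure" where
  "S \<equiv> \<Pi>\<^sub>M k\<in>(UNIV :: nat set). F"

lemma prob_space_S: "prob_space S"
  using prob_space_F by (intro prob_space_PiM)

definition P :: "nat \<Rightarrow> real \<Rightarrow> ennreal" where
  "P n u = (\<integral>\<^sup>+\<omega>. indicator {..u} (\<Sum>k<n. \<omega> k) \<partial>S)"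

text \<open>The probability that \<open>n\<close> switching times, preceded by an independent
  variable with density \<open>g\<close>, add up to at most \<open>u\<close>.\<close>

definition Q :: "nat \<Rightarrow> real \<Rightarrow> ennreal" where
  "Q n u = (\<integral>\<^sup>+z. g z * P n (u - z) \<partial>lborel)"

lemma borel_measurable_P [measurable]: "P n \<in> borel_measurable borel"
proof -
  interpret prob_space S
    by (rule prob_space_S)
  have "(\<lambda>u. \<integral>\<^sup>+\<omega>. (if (\<Sum>k<n. \<omega> k) \<le> u then 1 else 0) \<partial>S) \<in> borel_measurable borel"
    by measurable
  also have "(\<lambda>u. \<integral>\<^sup>+\<omega>. (if (\<Sum>k<n. \<omega> k) \<le> u then 1 else 0) \<partial>S) = P n"
    unfolding P_def by (intro ext nn_integral_cong) auto
  finally show ?thesis .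
qed

lemma P_0: "P 0 u = indicator {0..} u"
proof -
  interpret prob_space S
    by (rule prob_space_S)
  show ?thesis
    by (simp add: P_def emeasure_space_1 split: split_indicator)
qed

lemma P_Suc: "P (Suc n) u = (\<integral>\<^sup>+y. \<phi> y * P n (u - y) \<partial>lborel)"
proof -
  have "P (Suc n) u = (\<integral>\<^sup>+x. \<integral>\<^sup>+\<omega>. indicator {..u} (x + (\<Sum>k<n. \<omega> k)) \<partial>S \<partial>F)"
    unfolding P_def by (rule nn_integral_PiM_sum_Suc[OF prob_space_F]) auto
  also have "\<dots> = (\<integral>\<^sup>+x. P n (u - x) \<partial>F)"
    unfolding P_def by (intro nn_integral_cong) (auto split: split_indicator)
  finally show ?thesis
    by (simp add: nn_integral_density)
qed

text \<open>Decompose the first of the \<open>Suc n\<close> switching times: with equal probability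
  it is a variable with density \<open>g\<close> alone, or such a variable plus a fresh switching
  time.\<close>

lemma P_renewal: "2 * P (Suc n) u = Q n u + Q (Suc n) u"
proof -
  have "(\<integral>\<^sup>+y. \<phi> y * P n (u - (z + y)) \<partial>lborel) = P (Suc n) (u - z)" for z
    by (simp add: P_Suc diff_diff_eq)
  then show ?thesis
    using nn_integral_\<phi>_renewal[of "\<lambda>y. P n (u - y)"] by (simp add: P_Suc[of n u] Q_def)
qed

lemma P_le_one: "P n u \<le> 1"
proof -
  interpret prob_space S
    by (rule prob_space_S)
  have "P n u \<le> (\<integral>\<^sup>+\<omega>. 1 \<partial>S)"
    unfolding P_def by (intro nn_integral_mono) (auto split: split_indicator)
  then show ?thesis
    by (simp add: emeasure_space_1)
qed

text \<open>Chernoff bound: the probability is at most \<open>exp u\<close> times the n-th power of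
  the Laplace transform of \<open>\<phi>\<close> at 1, which is below 1 because
  \<open>\<phi>\<close> lives on the positive half-line.\<close>

lemma P_tendsto_0: "(\<lambda>n. enn2real (P n u)) \<longlonglongrightarrow> 0"
proof -
  define E where "E = (\<integral>\<^sup>+y. \<phi> y * ennreal (exp (- y)) \<partial>lborel)"
  have P_le: "P n u \<le> ennreal (exp u) * E ^ n" for n u
  proof (induction n arbitrary: u)
    case 0
    then show ?case
      by (auto simp: P_0 split: split_indicator)
  next
    case (Suc n)
    have exp_diff: "ennreal (exp (u - y)) = ennreal (exp u) * ennreal (exp (- y))" for y
      by (simp add: ennreal_mult[symmetric] mult_exp_exp)
    have "P (Suc n) u \<le> (\<integral>\<^sup>+y. \<phi> y * (ennreal (exp (u - y)) * E ^ n) \<partial>lborel)"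
      unfolding P_Suc by (intro nn_integral_mono mult_left_mono Suc.IH) simp
    also have "\<dots> = (\<integral>\<^sup>+y. ennreal (exp u) * E ^ n * (\<phi> y * ennreal (exp (- y))) \<partial>lborel)"
      unfolding exp_diff by (simp add: mult_ac)
    also have "\<dots> = ennreal (exp u) * E ^ n * E"
      unfolding E_def by (intro nn_integral_cmult) measurable
    finally show ?case
      by (simp add: mult_ac)
  qed
  have "E < (\<integral>\<^sup>+y. \<phi> y \<partial>lborel)"
    unfolding E_def
  proof (rule nn_integral_less)
    show "AE y in lborel. \<phi> y * ennreal (exp (- y)) \<le> \<phi> y"
    proof (rule AE_I2)
      fix y
      show "\<phi> y * ennreal (exp (- y)) \<le> \<phi> y"
        using \<phi>_nonpos[of y] mult_left_mono[of "ennreal (exp (- y))" 1 "\<phi> y"]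
        by (cases "y \<le> 0") auto
    qed
    then have "E \<le> (\<integral>\<^sup>+y. \<phi> y \<partial>lborel)"
      unfolding E_def by (rule nn_integral_mono_AE)
    then show "(\<integral>\<^sup>+y. \<phi> y * ennreal (exp (- y)) \<partial>lborel) \<noteq> \<infinity>"
      unfolding \<phi>_one E_def by (auto simp: top_unique)
    show "\<not> (AE y in lborel. \<phi> y \<le> \<phi> y * ennreal (exp (- y)))"
    proof
      assume "AE y in lborel. \<phi> y \<le> \<phi> y * ennreal (exp (- y))"
      then have "AE y in lborel. \<phi> y = 0"
      proof (rule eventually_mono)
        fix y
        assume *: "\<phi> y \<le> \<phi> y * ennreal (exp (- y))"
        show "\<phi> y = 0"
        proof (rule ccontr)
          assume "\<phi> y \<noteq> 0"
          then have y: "y > 0" "f y > 0"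
            using \<phi>_nonpos[of y] ennreal_f[of y] f_nonneg[of y]
            by (cases "y \<le> 0"; cases "f y = 0"; auto)+
          have "ennreal (f y) \<le> ennreal (f y * exp (- y))"
            using * f_nonneg[of y] by (simp add: ennreal_f[symmetric] ennreal_mult)
          then show False
            using y by (simp add: mult_le_cancel_left1)
        qed
      qed
      then have "(\<integral>\<^sup>+y. \<phi> y \<partial>lborel) = 0"
        by (subst nn_integral_0_iff_AE) auto
      then show False
        using \<phi>_one by simp
    qed
  qed simp_all
  then have E: "E < 1"
    by (simp add: \<phi>_one)
  then obtain e where e: "E = ennreal e" "0 \<le> e" "e < 1"
    by (cases E) (auto simp: ennreal_less_one_iff)
  have "enn2real (P n u) \<le> exp u * e ^ n" for n
  proof -
    have "P n u \<le> ennreal (exp u * e ^ n)"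
      using P_le[of n u] e by (simp add: ennreal_mult ennreal_power)
    then show ?thesis
      using e by (intro enn2real_leI) auto
  qed
  then have "\<forall>n. norm (enn2real (P n u)) \<le> exp u * e ^ n"
    by simp
  moreover have "(\<lambda>n. exp u * e ^ n) \<longlonglongrightarrow> 0"
    using e by (intro tendsto_mult_right_zero LIMSEQ_realpow_zero) auto
  ultimately show ?thesis
    by (rule Lim_null_comparison[OF always_eventually])
qed

lemma AE_S_nonneg: "AE \<omega> in S. \<forall>k. 0 \<le> \<omega> k"
proof -
  interpret F: prob_space F
    by (rule prob_space_F)
  interpret product_prob_space "\<lambda>_. F" "UNIV :: nat set" ..
  have "AE x in F. 0 \<le> x"
    using \<phi>_nonpos by (subst AE_density) (auto intro!: AE_I2, metis linear less_irrefl)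
  then have "AE \<omega> in S. 0 \<le> \<omega> k" for k
    by (intro AE_component) auto
  then show ?thesis
    by (simp add: AE_all_countable)
qed

lemma Q_0: "Q 0 u = cdf_of g u"
  unfolding Q_def cdf_of_def P_0 by (intro nn_integral_cong) (auto split: split_indicator)

text \<open>
  The switch process is a renewal process with interarrival density \<open>g\<close> in which every renewal is
  kept as a switch with probability 1/2. Given at least one renewal in \<open>[0, u]\<close>, the number of
  switches is therefore equally likely to be even or odd.
\<close>

lemma integral_switch_process:
  assumes "0 \<le> u"
  shows "(\<integral>\<omega>. switch_process \<omega> u \<partial>S) = 1 - enn2real (cdf_of g u)"
proof -
  interpret prob_space S
    by (rule prob_space_S)
  define a where "a n = enn2real (P n u)" for n
  define b where "b n = enn2real (Q n u)" for n
  define V where "V = (\<integral>\<omega>. switch_process \<omega> u \<partial>S)"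
  have P: "P n u = ennreal (a n)" for n
    unfolding a_def using le_less_trans[OF P_le_one ennreal_one_less_top] by simp
  have Q: "Q n u = ennreal (b n)" for n
  proof -
    have "Q n u \<le> 2 * P (Suc n) u"
      unfolding P_renewal by simp
    then show ?thesis
      unfolding b_def P using le_less_trans[of _ "2 * ennreal (a (Suc n))" top]
      by (simp add: ennreal_mult_less_top)
  qed
  have nonneg: "0 \<le> a n" "0 \<le> b n" for n
    by (auto simp: a_def b_def)
  have renewal: "2 * a (Suc n) = b n + b (Suc n)" for n
  proof -
    have "ennreal (2 * a (Suc n)) = ennreal (b n + b (Suc n))"
      using P_renewal[of n u] nonneg by (simp add: P Q ennreal_mult)
    then show ?thesis
      using nonneg by (subst (asm) ennreal_inj) auto
  qed
  have a_0: "a 0 = 1"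
    using \<open>0 \<le> u\<close> by (simp add: a_def P_0)
  \<comment> \<open>By \<open>renewal\<close>, each increment \<open>a n - a (Suc n)\<close> is the
    sum of two consecutive defects \<open>a n - b n\<close>. With alternating signs these
    telescope.\<close>
  have partial: "(\<Sum>n<N. (- 1) ^ n * (a n - a (Suc n))) = 1 - b 0 - (- 1) ^ N * (a N - b N)" for N
  proof (induction N)
    case (Suc N)
    have "a N - a (Suc N) = (a N - b N) + (a (Suc N) - b (Suc N))"
      using renewal[of N] by simp
    then have "(- 1) ^ N * (a N - a (Suc N)) =
        (- 1) ^ N * (a N - b N) + (- 1) ^ N * (a (Suc N) - b (Suc N))"
      by (simp only: distrib_left)
    then show ?case
      using Suc by simp
  qed (simp add: a_0)
  define s where "s n \<omega> = (indicator {..u} (\<Sum>k<n. \<omega> k) :: real)" for n and \<omega> :: "nat \<Rightarrow> real"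
  have s_meas [measurable]: "s n \<in> borel_measurable S" for n
    unfolding s_def by measurable
  have s_int: "integrable S (s n)" for n
    by (rule integrable_const_bound[where B = 1]) (auto simp: s_def indicator_def)
  have s_eq: "(\<integral>\<omega>. s n \<omega> \<partial>S) = a n" for n
    unfolding a_def P_def s_def
    by (subst integral_eq_nn_integral) (auto simp: ennreal_indicator)
  have "(\<lambda>\<omega>. switch_process \<omega> u) \<in> borel_measurable S"
    by measurable
  then have V_int: "integrable S (\<lambda>\<omega>. switch_process \<omega> u)"
    by (rule integrable_const_bound[rotated, where B = 1]) (simp add: switch_process_def power_abs)
  have truncated: "\<bar>V - (\<Sum>n<N. (- 1) ^ n * (a n - a (Suc n)))\<bar> \<le> a N" for N
  proof -
    have "V - (\<Sum>n<N. (- 1) ^ n * (a n - a (Suc n))) =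
        (\<integral>\<omega>. switch_process \<omega> u - (\<Sum>n<N. (- 1) ^ n * (s n \<omega> - s (Suc n) \<omega>)) \<partial>S)"
      using s_int V_int by (simp add: V_def s_eq)
    also have "\<bar>\<dots>\<bar> \<le>
        (\<integral>\<omega>. \<bar>switch_process \<omega> u - (\<Sum>n<N. (- 1) ^ n * (s n \<omega> - s (Suc n) \<omega>))\<bar> \<partial>S)"
      by (rule integral_abs_bound)
    also have "\<dots> \<le> (\<integral>\<omega>. s N \<omega> \<partial>S)"
    proof (rule integral_mono_AE)
      show "AE \<omega> in S. \<bar>switch_process \<omega> u - (\<Sum>n<N. (- 1) ^ n * (s n \<omega> - s (Suc n) \<omega>))\<bar> \<le> s N \<omega>"
        using AE_S_nonneg
      proof (rule eventually_mono)
        fix \<omega> :: "nat \<Rightarrow> real"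
        assume "\<forall>k. 0 \<le> \<omega> k"
        then show "\<bar>switch_process \<omega> u - (\<Sum>n<N. (- 1) ^ n * (s n \<omega> - s (Suc n) \<omega>))\<bar> \<le> s N \<omega>"
          unfolding s_def by (intro switch_process_expansion \<open>0 \<le> u\<close>) auto
      qed
    qed (use s_int V_int in simp_all)
    finally show ?thesis
      by (simp add: s_eq)
  qed
  \<comment> \<open>Truncation costs \<open>a N\<close>; the boundary term costs at most
    \<open>a N + b N\<close>, and \<open>b N\<close> is at most \<open>2 * a (Suc N)\<close>. All of
    this tends to 0.\<close>
  have bound: "\<bar>V - (1 - b 0)\<bar> \<le> 2 * a N + 2 * a (Suc N)" for N
  proof -
    have "\<bar>(- 1) ^ N * (a N - b N)\<bar> = \<bar>a N - b N\<bar>"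
      by (simp add: abs_mult power_abs)
    moreover have "\<bar>a N - b N\<bar> \<le> a N + 2 * a (Suc N)"
      using nonneg[of N] nonneg[of "Suc N"] renewal[of N] by linarith
    moreover have "\<bar>V - (1 - b 0 - (- 1) ^ N * (a N - b N))\<bar> \<le> a N"
      using truncated[of N] by (simp add: partial)
    ultimately show ?thesis
      by linarith
  qed
  have a_lim: "a \<longlonglongrightarrow> 0"
    using P_tendsto_0[of u] by (simp add: a_def[abs_def])
  have "(\<lambda>N. 2 * a N + 2 * a (Suc N)) \<longlonglongrightarrow> 2 * 0 + 2 * 0"
    by (intro tendsto_add tendsto_mult tendsto_const a_lim LIMSEQ_Suc[OF a_lim])
  then have "\<bar>V - (1 - b 0)\<bar> \<le> 2 * 0 + 2 * 0"
    by (rule LIMSEQ_le_const) (use bound in auto)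
  then show ?thesis
    by (simp add: V_def b_def Q_0)
qed

end

section \<open>The covariance of the stationary switch process\<close>

lemma distr_snd_pair_measure:
  assumes "prob_space M" "prob_space N"
  shows "distr (M \<Otimes>\<^sub>M N) N snd = N"
proof (rule measure_eqI)
  interpret M: prob_space M by fact
  interpret N: prob_space N by fact
  fix A
  assume "A \<in> sets (distr (M \<Otimes>\<^sub>M N) N snd)"
  then have A: "A \<in> sets N"
    by simp
  then have "snd -` A \<inter> space (M \<Otimes>\<^sub>M N) = space M \<times> A"
    using sets.sets_into_space by (auto simp: space_pair_measure)
  then show "emeasure (distr (M \<Otimes>\<^sub>M N) N snd) A = emeasure N A"
    using A by (simp add: emeasure_distr N.emeasure_pair_measure_Times M.emeasure_space_1)
qed simp

context thinned_renewal
begin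

text \<open>The common law of \<open>A\<close> and \<open>B\<close>.\<close>

abbreviation delay :: "real measure" where
  "delay \<equiv> density lborel (\<lambda>a. tail_of \<phi> a / ennreal (switching_mean f))"

lemma nn_integral_f_tail:
  "0 \<le> a \<Longrightarrow> (\<integral>\<^sup>+b. ennreal (if 0 \<le> a \<and> 0 \<le> b then f (a + b) / switching_mean f else 0) \<partial>lborel) =
    tail_of \<phi> a / ennreal (switching_mean f)"
proof -
  assume a: "0 \<le> a"
  have "(\<integral>\<^sup>+b. ennreal (if 0 \<le> a \<and> 0 \<le> b then f (a + b) / switching_mean f else 0) \<partial>lborel) =
      (\<integral>\<^sup>+b. \<phi> (a + b) * indicator {a<..} (a + b) / ennreal (switching_mean f) \<partial>lborel)"
  proof (rule nn_integral_cong_AE)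
    \<comment> \<open>The joint density admits \<open>b = 0\<close>, whereas the tail integrates
      over the open half-line; the difference is a null set.\<close>
    have "AE b in lborel. b \<noteq> (0 :: real)"
      by (rule AE_lborel_singleton)
    then show "AE b in lborel.
        ennreal (if 0 \<le> a \<and> 0 \<le> b then f (a + b) / switching_mean f else 0) =
        \<phi> (a + b) * indicator {a<..} (a + b) / ennreal (switching_mean f)"
      by (rule eventually_mono)
        (use a f_nonneg switching_mean_pos in
          \<open>auto simp: ennreal_f[symmetric] divide_ennreal split: split_indicator\<close>)
  qed
  also have "\<dots> = (\<integral>\<^sup>+b. \<phi> (a + b) * indicator {a<..} (a + b) \<partial>lborel) / ennreal (switching_mean f)"
    by (intro nn_integral_divide) measurable
  also have "(\<integral>\<^sup>+b. \<phi> (a + b) * indicator {a<..} (a + b) \<partial>lborel) = tail_of \<phi> a"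
    using a unfolding tail_of_def
    by (subst (2) nn_integral_real_affine[where c = 1 and t = a]) auto
  finally show ?thesis .
qed

text \<open>The joint density is symmetric in its arguments, so one computation serves both
  marginals.\<close>

lemma nn_integral_delay_dist:
  assumes [measurable]: "h \<in> borel_measurable borel"
  shows "(\<integral>\<^sup>+x. h (fst x) \<partial>delay_dist f) = (\<integral>\<^sup>+a. h a \<partial>delay)"
    and "(\<integral>\<^sup>+x. h (snd x) \<partial>delay_dist f) = (\<integral>\<^sup>+a. h a \<partial>delay)"
proof -
  let ?k = "\<lambda>a b. ennreal (if 0 \<le> a \<and> 0 \<le> b then f (a + b) / switching_mean f else 0)"
  have k: "(\<integral>\<^sup>+b. ?k a b \<partial>lborel) = tail_of \<phi> a / ennreal (switching_mean f)" for a
    using nn_integral_f_tail[of a] by (cases "0 \<le> a") (auto simp: tail_of_def)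
  have k_sym: "?k a b = ?k b a" for a b
    by (simp add: add.commute)
  have "(\<integral>\<^sup>+x. h (fst x) \<partial>delay_dist f) = (\<integral>\<^sup>+a. \<integral>\<^sup>+b. ?k a b * h a \<partial>lborel \<partial>lborel)"
    unfolding delay_dist_def
    by (subst nn_integral_density)
      (auto simp: case_prod_beta' lborel.nn_integral_fst[symmetric] cong: if_cong)
  also have "\<dots> = (\<integral>\<^sup>+a. tail_of \<phi> a / ennreal (switching_mean f) * h a \<partial>lborel)"
    by (subst nn_integral_multc) (simp_all only: k, measurable)
  finally show "(\<integral>\<^sup>+x. h (fst x) \<partial>delay_dist f) = (\<integral>\<^sup>+a. h a \<partial>delay)"
    by (simp add: nn_integral_density)
  have "(\<integral>\<^sup>+x. h (snd x) \<partial>delay_dist f) = (\<integral>\<^sup>+a. \<integral>\<^sup>+b. ?k a b * h b \<partial>lborel \<partial>lborel)"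
    unfolding delay_dist_def
    by (subst nn_integral_density)
      (auto simp: case_prod_beta' lborel.nn_integral_fst[symmetric] cong: if_cong)
  also have "\<dots> = (\<integral>\<^sup>+b. \<integral>\<^sup>+a. ?k b a * h b \<partial>lborel \<partial>lborel)"
    by (subst lborel_pair.Fubini')
      (auto simp: add.commute conj_commute intro!: nn_integral_cong cong: if_cong)
  also have "\<dots> = (\<integral>\<^sup>+a. tail_of \<phi> a / ennreal (switching_mean f) * h a \<partial>lborel)"
    by (subst nn_integral_multc) (simp_all only: k, measurable)
  finally show "(\<integral>\<^sup>+x. h (snd x) \<partial>delay_dist f) = (\<integral>\<^sup>+a. h a \<partial>delay)"
    by (simp add: nn_integral_density)
qed

lemma sets_delay_dist [measurable_cong]: "sets (delay_dist f) = sets (borel \<Otimes>\<^sub>M borel)"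
  by (simp add: delay_dist_def cong: sets_pair_measure_cong)

lemma distr_delay_dist:
  "distr (delay_dist f) borel fst = delay" "distr (delay_dist f) borel snd = delay"
  by (rule measure_eqI;
      simp add: nn_integral_indicator[symmetric] nn_integral_distr nn_integral_delay_dist
        del: nn_integral_indicator)+

lemma prob_space_delay: "prob_space delay"
proof
  have "emeasure delay (space delay) =
      (\<integral>\<^sup>+a. tail_of \<phi> a \<partial>lborel) / ennreal (switching_mean f)"
    by (simp add: emeasure_density nn_integral_divide)
  then show "emeasure delay (space delay) = 1"
    using switching_mean_pos
    by (simp add: ennreal_switching_mean[symmetric] divide_ennreal)
qed

lemma prob_space_delay_dist: "prob_space (delay_dist f)"
proof
  interpret prob_space delay
    by (rule prob_space_delay)
  have "emeasure (delay_dist f) (space (delay_dist f)) = (\<integral>\<^sup>+x. 1 \<partial>delay_dist f)"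
    by simp
  also have "\<dots> = 1"
    using nn_integral_delay_dist(1)[of "\<lambda>_. 1"] emeasure_space_1 by simp
  finally show "emeasure (delay_dist f) (space (delay_dist f)) = 1" .
qed

lemma AE_delay_pos: "AE a in delay. 0 < a"
proof -
  have "AE a in lborel. a \<noteq> (0 :: real)"
    by (rule AE_lborel_singleton)
  then have "AE a in lborel. tail_of \<phi> a / ennreal (switching_mean f) > 0 \<longrightarrow> 0 < a"
    by (rule eventually_mono) (auto simp: tail_of_def)
  then show ?thesis
    by (subst AE_density) simp_all
qed

text \<open>The value of \<open>Y(s) Y(0)\<close> for \<open>s \<ge> 0\<close>, \<open>A = a > 0\<close>, \<open>B > 0\<close> and right switching times \<open>T\<close>.\<close>

definition H :: "real \<Rightarrow> (nat \<Rightarrow> real) \<times> real \<Rightarrow> real" where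
  "H s = (\<lambda>(T, a). if s < a then 1 else - switch_process T (s - a))"

lemma borel_measurable_H [measurable]: "H s \<in> borel_measurable (S \<Otimes>\<^sub>M borel)"
  unfolding H_def by measurable

lemma H_bounded: "\<bar>H s x\<bar> \<le> 1"
  by (auto simp: H_def switch_process_def power_abs split: prod.split)

text \<open>Given \<open>A = a\<close> with \<open>a \<le> s\<close>, the mean of the switch process
  turns the conditional expectation into \<open>1 - w a\<close> with
  \<open>w a = 2 - G(s - a)\<close>. The truncated renewal identity evaluates the integral of
  \<open>w\<close> against the tail of \<open>\<phi>\<close>, and the factor 2 cancels against
  Wald's identity.\<close>

lemma integral_H:
  assumes "0 \<le> s"
  shows "(\<integral>x. H s x \<partial>(S \<Otimes>\<^sub>M delay)) =
    1 - enn2real (\<integral>\<^sup>+u. tail_of g u * indicator {..s} u \<partial>lborel) / enn2real (\<integral>\<^sup>+u. tail_of g u \<partial>lborel)"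
proof -
  interpret S: prob_space S by (rule prob_space_S)
  interpret D: prob_space delay by (rule prob_space_delay)
  interpret SD: pair_prob_space S delay ..
  have meas: "H s \<in> borel_measurable (S \<Otimes>\<^sub>M delay)"
    by measurable
  have int: "integrable (S \<Otimes>\<^sub>M delay) (\<lambda>(T, a). H s (T, a))"
    using meas H_bounded by (intro SD.integrable_const_bound[where B = 1]) (auto simp: case_prod_beta')
  define w where "w a = (2 - enn2real (cdf_of g (s - a))) * indicator {..s} a" for a
  have cdf: "cdf_of g u = ennreal (enn2real (cdf_of g u))" for u
    using le_less_trans[OF cdf_of_le_one ennreal_one_less_top] by simp
  have cdf_real: "0 \<le> enn2real (cdf_of g u)" "enn2real (cdf_of g u) \<le> 1" for u
    using cdf_of_le_one by (auto intro!: enn2real_leI)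
  have w_meas [measurable]: "w \<in> borel_measurable borel"
    unfolding w_def by measurable
  have w_bounds: "0 \<le> w a" "w a \<le> 2" for a
    using cdf_real[of "s - a"] by (auto simp: w_def split: split_indicator)
  have "(\<integral>x. H s x \<partial>(S \<Otimes>\<^sub>M delay)) = (\<integral>a. \<integral>T. H s (T, a) \<partial>S \<partial>delay)"
    using SD.integral_snd[OF int] by simp
  also have "\<dots> = (\<integral>a. 1 - w a \<partial>delay)"
  proof (rule Bochner_Integration.integral_cong)
    fix a
    show "(\<integral>T. H s (T, a) \<partial>S) = 1 - w a"
      by (cases "a \<le> s") (auto simp: H_def w_def integral_switch_process S.prob_space)
  qed simp
  also have "\<dots> = 1 - (\<integral>a. w a \<partial>delay)"
    using w_bounds D.prob_space
    by (subst Bochner_Integration.integral_diff) (auto intro!: D.integrable_const_bound[where B = 2])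
  also have "(\<integral>a. w a \<partial>delay) = enn2real (\<integral>\<^sup>+a. ennreal (w a) \<partial>delay)"
    using w_bounds by (intro integral_eq_nn_integral) auto
  also have "(\<integral>\<^sup>+a. ennreal (w a) \<partial>delay) =
      (\<integral>\<^sup>+a. tail_of \<phi> a * ennreal (w a) \<partial>lborel) / ennreal (switching_mean f)"
    by (simp add: nn_integral_density nn_integral_divide[symmetric] ennreal_times_divide mult.commute)
  also have "(\<integral>\<^sup>+a. tail_of \<phi> a * ennreal (w a) \<partial>lborel) =
      2 * (\<integral>\<^sup>+u. tail_of g u * indicator {..s} u \<partial>lborel)"
  proof -
    let ?C = "\<integral>\<^sup>+a. tail_of \<phi> a * cdf_of g (s - a) \<partial>lborel"
    \<comment> \<open>The minus sign in \<open>w\<close> is avoided by adding the finite quantity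
      \<open>?C\<close> to both sides and cancelling it afterwards.\<close>
    have "ennreal (w a) + cdf_of g (s - a) = 2 * indicator {..s} a" for a
    proof (cases "a \<le> s")
      case True
      have "ennreal (w a) + cdf_of g (s - a) = ennreal (w a + enn2real (cdf_of g (s - a)))"
        using w_bounds cdf_real by (subst (1) cdf) (simp add: ennreal_plus)
      then show ?thesis
        using True by (simp add: w_def)
    qed (simp add: w_def cdf_of_neg)
    then have "(\<integral>\<^sup>+a. tail_of \<phi> a * ennreal (w a) \<partial>lborel) + ?C =
        (\<integral>\<^sup>+a. 2 * (tail_of \<phi> a * indicator {..s} a) \<partial>lborel)"
      by (subst nn_integral_add[symmetric]) (auto simp: distrib_left[symmetric] mult.left_commute)
    also have "\<dots> = 2 * (\<integral>\<^sup>+a. tail_of \<phi> a * indicator {..s} a \<partial>lborel)"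
      by (intro nn_integral_cmult) measurable
    finally have "?C + (\<integral>\<^sup>+a. tail_of \<phi> a * ennreal (w a) \<partial>lborel) =
        ?C + 2 * (\<integral>\<^sup>+u. tail_of g u * indicator {..s} u \<partial>lborel)"
      by (simp add: tail_renewal_upto add.commute)
    moreover have "?C \<le> (\<integral>\<^sup>+u. tail_of \<phi> u * indicator {..s} u \<partial>lborel)"
      by (intro nn_integral_mono tail_cdf_le)
    then have "?C \<noteq> \<infinity>"
      using nn_integral_tail_upto_finite[of s] by (auto simp: top_unique)
    ultimately show ?thesis
      by (simp add: ennreal_add_left_cancel)
  qed
  also have "enn2real (2 * (\<integral>\<^sup>+u. tail_of g u * indicator {..s} u \<partial>lborel) / ennreal (switching_mean f)) =
      enn2real (\<integral>\<^sup>+u. tail_of g u * indicator {..s} u \<partial>lborel) / enn2real (\<integral>\<^sup>+u. tail_of g u \<partial>lborel)"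
  proof -
    have "switching_mean f = enn2real (2 * (\<integral>\<^sup>+u. tail_of g u \<partial>lborel))"
      using ennreal_switching_mean switching_mean_pos by (metis enn2real_ennreal less_imp_le mean_tail)
    then have mean_eq: "switching_mean f = 2 * enn2real (\<integral>\<^sup>+u. tail_of g u \<partial>lborel)"
      by (simp add: enn2real_mult)
    have "(\<integral>\<^sup>+u. tail_of g u * indicator {..s} u \<partial>lborel) \<le> (\<integral>\<^sup>+u. tail_of g u \<partial>lborel)"
      by (intro nn_integral_mono) (auto split: split_indicator)
    then have fin: "(\<integral>\<^sup>+u. tail_of g u * indicator {..s} u \<partial>lborel) < top"
      using mean by (auto intro: le_less_trans)
    then obtain z where z: "(\<integral>\<^sup>+u. tail_of g u * indicator {..s} u \<partial>lborel) = ennreal z" "0 \<le> z"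
      by (cases "\<integral>\<^sup>+u. tail_of g u * indicator {..s} u \<partial>lborel") auto
    have "2 * ennreal z = ennreal (2 * z)"
      using z by (simp add: ennreal_mult)
    then show ?thesis
      using z switching_mean_pos mean_eq by (simp add: divide_ennreal)
  qed
  finally show ?thesis .
qed

lemma switch_space_f:
  "switch_space f = S \<Otimes>\<^sub>M S \<Otimes>\<^sub>M delay_dist f \<Otimes>\<^sub>M measure_pmf (pmf_of_set {- 1, 1})"
  by (simp add: switch_space_def switching_dist_f)

text \<open>Almost surely the value at time 0 is \<open>- \<delta>\<close>, and
  \<open>\<delta>\<close> squares to 1. The product of the two values is thus \<open>H s\<close> of
  the right times and A for time \<open>s\<close>, and of the left times and B for time
  \<open>- s\<close>.\<close>

lemma switch_covariance_f:
  assumes "0 \<le> s"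
  shows "switch_covariance f s = (\<integral>x. H s x \<partial>(S \<Otimes>\<^sub>M delay))"
    and "switch_covariance f (- s) = (\<integral>x. H s x \<partial>(S \<Otimes>\<^sub>M delay))"
proof -
  let ?\<delta> = "measure_pmf (pmf_of_set {- 1, 1 :: real})"
  let ?R1 = "delay_dist f \<Otimes>\<^sub>M ?\<delta>"
  let ?R2 = "S \<Otimes>\<^sub>M ?R1"
  let ?W = "S \<Otimes>\<^sub>M ?R2"
  interpret S: prob_space S by (rule prob_space_S)
  interpret D: prob_space "delay_dist f" by (rule prob_space_delay_dist)
  interpret A: prob_space delay by (rule prob_space_delay)
  interpret R1: pair_prob_space "delay_dist f" ?\<delta> ..
  interpret R2: pair_prob_space S ?R1 ..
  interpret W: pair_prob_space S ?R2 ..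
  have R2_dist: "distr ?W ?R2 snd = ?R2" and R1_dist: "distr ?R2 ?R1 snd = ?R1"
    and \<delta>_dist: "distr ?R1 ?\<delta> snd = ?\<delta>" and D_dist: "distr ?R1 (delay_dist f) fst = delay_dist f"
    by (intro distr_snd_pair_measure prob_space.distr_pair_fst; unfold_locales)+
  define \<delta> where "\<delta> \<omega> = snd (snd (snd \<omega>))" for \<omega> :: switch_sample
  \<comment> \<open>A and B are dependent, but each of the pairs \<open>RA\<close> and
    \<open>LB\<close> contains only one of them, so both have the product law
    \<open>S \<Otimes>\<^sub>M delay\<close>.\<close>
  define RA where "RA \<omega> = (fst \<omega>, fst (fst (snd (snd \<omega>))))" for \<omega> :: switch_sample
  define LB where "LB \<omega> = (fst (snd \<omega>), snd (fst (snd (snd \<omega>))))" for \<omega> :: switch_sample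
  have \<delta>_meas: "\<delta> \<in> measurable ?W ?\<delta>"
    unfolding \<delta>_def by (intro measurable_compose[OF measurable_snd] measurable_snd)
  have [measurable]: "\<delta> \<in> borel_measurable ?W"
    using measurable_compose[OF \<delta>_meas, of "\<lambda>x. x" borel] by simp
  have AB_meas: "(\<lambda>\<omega>. h (fst (snd (snd \<omega>)))) \<in> borel_measurable ?W"
    if "h \<in> borel_measurable (delay_dist f)" for h
    by (intro measurable_compose[OF measurable_snd] measurable_compose[OF measurable_fst that])
  have RA_meas [measurable]: "RA \<in> measurable ?W (S \<Otimes>\<^sub>M borel)"
    and LB_meas [measurable]: "LB \<in> measurable ?W (S \<Otimes>\<^sub>M borel)"
    unfolding RA_def LB_def
    by (intro measurable_Pair AB_meas measurable_fst measurable_compose[OF measurable_snd measurable_fst];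
        measurable)+
  have \<delta>_W: "distr ?W ?\<delta> \<delta> = ?\<delta>"
  proof -
    have "distr ?W ?\<delta> \<delta> = distr (distr (distr ?W ?R2 snd) ?R1 snd) ?\<delta> snd"
      by (subst distr_distr, simp, simp)+ (simp add: \<delta>_def[abs_def] comp_def)
    then show ?thesis
      by (simp only: R2_dist R1_dist \<delta>_dist)
  qed
  have R1_AB: "distr ?R1 borel (\<lambda>x. fst (fst x)) = delay" "distr ?R1 borel (\<lambda>x. snd (fst x)) = delay"
  proof -
    have eq: "distr ?R1 borel (\<lambda>x. h (fst x)) = distr (delay_dist f) borel h"
      if "h \<in> borel_measurable (delay_dist f)" for h
      using distr_distr[OF that measurable_fst, of ?\<delta>] by (simp add: comp_def D_dist)
    show "distr ?R1 borel (\<lambda>x. fst (fst x)) = delay" "distr ?R1 borel (\<lambda>x. snd (fst x)) = delay"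
      using eq[of fst] eq[of snd] by (simp_all add: distr_delay_dist)
  qed
  have RA_W: "distr ?W (S \<Otimes>\<^sub>M borel) RA = S \<Otimes>\<^sub>M delay"
  proof -
    have "distr ?R2 borel (\<lambda>y. fst (fst (snd y))) = distr (distr ?R2 ?R1 snd) borel (\<lambda>x. fst (fst x))"
      by (subst distr_distr) (auto simp: comp_def)
    then have "distr ?R2 borel (\<lambda>y. fst (fst (snd y))) = delay"
      by (simp only: R1_dist R1_AB)
    then have "S \<Otimes>\<^sub>M delay = distr S S (\<lambda>x. x) \<Otimes>\<^sub>M distr ?R2 borel (\<lambda>y. fst (fst (snd y)))"
      by (simp add: distr_id)
    also have "\<dots> = distr ?W (S \<Otimes>\<^sub>M borel) (\<lambda>(x, y). (x, fst (fst (snd y))))"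
      by (rule pair_measure_distr)
        (simp_all add: \<open>distr ?R2 borel (\<lambda>y. fst (fst (snd y))) = delay\<close> A.sigma_finite_measure)
    finally show ?thesis
      by (simp add: RA_def[abs_def] case_prod_beta')
  qed
  have LB_W: "distr ?W (S \<Otimes>\<^sub>M borel) LB = S \<Otimes>\<^sub>M delay"
  proof -
    have "S \<Otimes>\<^sub>M delay = distr S S (\<lambda>x. x) \<Otimes>\<^sub>M distr ?R1 borel (\<lambda>y. snd (fst y))"
      by (simp add: R1_AB distr_id)
    also have "\<dots> = distr ?R2 (S \<Otimes>\<^sub>M borel) (\<lambda>(x, y). (x, snd (fst y)))"
      by (rule pair_measure_distr) (simp_all add: R1_AB A.sigma_finite_measure)
    also have "\<dots> = distr (distr ?W ?R2 snd) (S \<Otimes>\<^sub>M borel) (\<lambda>(x, y). (x, snd (fst y)))"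
      by (simp only: R2_dist)
    also have "\<dots> = distr ?W (S \<Otimes>\<^sub>M borel) LB"
      by (subst distr_distr) (auto simp: comp_def LB_def[abs_def] case_prod_beta')
    finally show ?thesis
      by simp
  qed
  have pos: "AE x in S \<Otimes>\<^sub>M delay. 0 < snd x"
  proof -
    have "AE a in distr (S \<Otimes>\<^sub>M delay) delay snd. 0 < a"
      using AE_delay_pos
      by (subst distr_snd_pair_measure) (auto intro: S.prob_space_axioms A.prob_space_axioms)
    then show ?thesis
      by (rule AE_distrD[rotated]) simp
  qed
  have AE_A: "AE \<omega> in ?W. 0 < snd (RA \<omega>)"
    by (rule AE_distrD[of RA ?W "S \<Otimes>\<^sub>M borel"]) (measurable, simp only: RA_W pos)
  have AE_B: "AE \<omega> in ?W. 0 < snd (LB \<omega>)"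
    by (rule AE_distrD[of LB ?W "S \<Otimes>\<^sub>M borel"]) (measurable, simp only: LB_W pos)
  have AE_\<delta>: "AE \<omega> in ?W. \<delta> \<omega> = 1 \<or> \<delta> \<omega> = - 1"
  proof (rule AE_distrD[of \<delta> ?W ?\<delta>])
    show "AE x in distr ?W ?\<delta> \<delta>. x = 1 \<or> x = - 1"
      unfolding \<delta>_W by (auto simp: AE_measure_pmf_iff)
  qed (rule \<delta>_meas)
  have Y_eq: "stationary_switch_process t = (\<lambda>\<omega>.
      if - snd (LB \<omega>) < t \<and> t < snd (RA \<omega>) then - \<delta> \<omega>
      else if snd (RA \<omega>) \<le> t then \<delta> \<omega> * switch_process (fst (RA \<omega>)) (t - snd (RA \<omega>))
      else \<delta> \<omega> * switch_process (fst (LB \<omega>)) (- (t + snd (LB \<omega>))))" for t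
    by (auto simp: stationary_switch_process_def \<delta>_def RA_def LB_def split: prod.split)
  have comp [measurable]: "(\<lambda>\<omega>. fst (RA \<omega>) k) \<in> borel_measurable ?W"
    "(\<lambda>\<omega>. fst (LB \<omega>) k) \<in> borel_measurable ?W"
    "(\<lambda>\<omega>. snd (RA \<omega>)) \<in> borel_measurable ?W" "(\<lambda>\<omega>. snd (LB \<omega>)) \<in> borel_measurable ?W" for k
  proof -
    have k: "(\<lambda>T. T k) \<in> borel_measurable S"
      by measurable
    show "(\<lambda>\<omega>. fst (RA \<omega>) k) \<in> borel_measurable ?W" "(\<lambda>\<omega>. fst (LB \<omega>) k) \<in> borel_measurable ?W"
      by (rule measurable_compose[OF _ measurable_compose[OF measurable_fst k]], rule RA_meas LB_meas)+
    show "(\<lambda>\<omega>. snd (RA \<omega>)) \<in> borel_measurable ?W" "(\<lambda>\<omega>. snd (LB \<omega>)) \<in> borel_measurable ?W"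
      by (rule measurable_compose[OF _ measurable_snd], rule RA_meas LB_meas)+
  qed
  have Y_meas [measurable]: "stationary_switch_process t \<in> borel_measurable ?W" for t
    unfolding Y_eq by measurable
  have AE_Y0: "AE \<omega> in ?W. stationary_switch_process 0 \<omega> = - \<delta> \<omega>"
    using AE_A AE_B by eventually_elim
      (simp add: Y_eq)
  have mean_\<delta>: "(\<integral>\<omega>. \<delta> \<omega> \<partial>?W) = 0"
  proof -
    have "(\<integral>\<omega>. \<delta> \<omega> \<partial>?W) = (\<integral>x. x \<partial>distr ?W ?\<delta> \<delta>)"
      by (subst integral_distr[OF \<delta>_meas]) auto
    also have "\<dots> = 0"
      unfolding \<delta>_W by (subst integral_pmf_of_set) auto
    finally show ?thesis .
  qed
  have Y0_mean: "(\<integral>\<omega>. stationary_switch_process 0 \<omega> \<partial>?W) = 0"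
    using integral_cong_AE[OF _ _ AE_Y0] mean_\<delta> by simp
  have int_\<delta>: "integrable ?W \<delta>"
    using AE_\<delta> by (intro W.integrable_const_bound[where B = 1]) (auto elim!: eventually_mono)
  \<comment> \<open>The mean \<open>m\<close> of the process at time \<open>t\<close> enters only
    multiplied by the mean of \<open>\<delta>\<close>, which is 0; its value is never
    computed.\<close>
  have cov: "switch_covariance f t = (\<integral>\<omega>. h \<omega> \<partial>?W)"
    if [measurable]: "h \<in> borel_measurable ?W" and h_bound: "\<And>\<omega>. \<bar>h \<omega>\<bar> \<le> 1"
      and h: "AE \<omega> in ?W. stationary_switch_process t \<omega> * - \<delta> \<omega> = h \<omega>" for t h
  proof -
    define m where "m = (\<integral>\<omega>. stationary_switch_process t \<omega> \<partial>?W)"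
    have "switch_covariance f t =
        (\<integral>\<omega>. (stationary_switch_process t \<omega> - m) * stationary_switch_process 0 \<omega> \<partial>?W)"
      by (simp add: switch_covariance_def covariance_def switch_space_f Y0_mean m_def)
    also have "\<dots> = (\<integral>\<omega>. h \<omega> + m * \<delta> \<omega> \<partial>?W)"
      using h AE_Y0 by (intro integral_cong_AE) (auto elim!: eventually_elim2 simp: algebra_simps)
    also have "\<dots> = (\<integral>\<omega>. h \<omega> \<partial>?W)"
      using int_\<delta> h_bound mean_\<delta>
      by (subst Bochner_Integration.integral_add) (auto intro!: W.integrable_const_bound[where B = 1])
    finally show ?thesis .
  qed
  have "switch_covariance f s = (\<integral>\<omega>. H s (RA \<omega>) \<partial>?W)"
  proof (rule cov)
    show "AE \<omega> in ?W. stationary_switch_process s \<omega> * - \<delta> \<omega> = H s (RA \<omega>)"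
      using AE_A AE_B AE_\<delta>
      by eventually_elim (use assms in \<open>auto simp: Y_eq H_def case_prod_beta'\<close>)
  qed (use H_bounded in simp_all)
  also have "\<dots> = (\<integral>x. H s x \<partial>distr ?W (S \<Otimes>\<^sub>M borel) RA)"
    by (rule integral_distr[symmetric]) simp_all
  finally show "switch_covariance f s = (\<integral>x. H s x \<partial>(S \<Otimes>\<^sub>M delay))"
    by (simp only: RA_W)
  have "switch_covariance f (- s) = (\<integral>\<omega>. H s (LB \<omega>) \<partial>?W)"
  proof (rule cov)
    show "AE \<omega> in ?W. stationary_switch_process (- s) \<omega> * - \<delta> \<omega> = H s (LB \<omega>)"
      using AE_A AE_B AE_\<delta>
      by eventually_elim (use assms in \<open>auto simp: Y_eq H_def case_prod_beta'\<close>)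
  qed (use H_bounded in simp_all)
  also have "\<dots> = (\<integral>x. H s x \<partial>distr ?W (S \<Otimes>\<^sub>M borel) LB)"
    by (rule integral_distr[symmetric]) simp_all
  finally show "switch_covariance f (- s) = (\<integral>x. H s x \<partial>(S \<Otimes>\<^sub>M delay))"
    by (simp only: LB_W)
qed

end

lemma (in thinned_renewal) switch_covariance_eq:
  "switch_covariance f t =
    1 - enn2real (\<integral>\<^sup>+u. tail_of g u * indicator {..\<bar>t\<bar>} u \<partial>lborel) /
      enn2real (\<integral>\<^sup>+u. tail_of g u \<partial>lborel)"
  using switch_covariance_f[of "\<bar>t\<bar>"] integral_H[of "\<bar>t\<bar>"] by (cases "0 \<le> t") simp_all

section \<open>Convex covariance functions\<close>

text \<open>A derivative need not be continuous, but it is the pointwise limit of difference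
  quotients. This serves the second derivative of c, for which only existence is known.\<close>

lemma borel_measurable_derivative_greaterThan:
  fixes F f :: "real \<Rightarrow> real"
  assumes deriv: "\<And>x. x > 0 \<Longrightarrow> (F has_real_derivative f x) (at x)"
  shows "(\<lambda>x. if x \<in> {0<..} then F x else 0) \<in> borel_measurable borel"
    and "(\<lambda>x. if x \<in> {0<..} then f x else 0) \<in> borel_measurable borel"
proof -
  define G where "G x = (if x \<in> {0<..} then F x else 0)" for x
  have "G \<in> borel_measurable borel"
    unfolding G_def
    by (intro borel_measurable_continuous_on_if)
      (auto intro!: continuous_at_imp_continuous_on DERIV_isCont deriv)
  then show "(\<lambda>x. if x \<in> {0<..} then F x else 0) \<in> borel_measurable borel"
    by (simp add: G_def[abs_def])
  note [measurable] = \<open>G \<in> borel_measurable borel\<close>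
  show "(\<lambda>x. if x \<in> {0<..} then f x else 0) \<in> borel_measurable borel"
  proof (rule borel_measurable_LIMSEQ_real)
    fix x :: real
    show "(\<lambda>n. if x \<in> {0<..} then (G (x + inverse (real (Suc n))) - G x) / inverse (real (Suc n)) else 0)
        \<longlonglongrightarrow> (if x \<in> {0<..} then f x else 0)"
    proof (cases "x \<in> {0<..}")
      case True
      have "filterlim (\<lambda>n. inverse (real (Suc n))) (at 0) sequentially"
        using LIMSEQ_inverse_real_of_nat by (auto simp: filterlim_at)
      moreover have "((\<lambda>h. (F (x + h) - F x) / h) \<longlongrightarrow> f x) (at 0)"
        using deriv[of x] True by (simp add: DERIV_def)
      ultimately have "(\<lambda>n. (F (x + inverse (real (Suc n))) - F x) / inverse (real (Suc n))) \<longlonglongrightarrow> f x"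
        by (rule filterlim_compose[rotated])
      moreover have "x + inverse (real (Suc n)) > 0" for n
        using True by (intro add_pos_pos) auto
      ultimately show ?thesis
        using True by (simp add: G_def)
    qed simp
  qed measurable
qed

text \<open>The fundamental theorem is applied on \<open>{a..}\<close> with \<open>a > 0\<close>,
  since nothing is differentiable at 0; monotone convergence then reaches the open
  half-line.\<close>

lemma nn_integral_greaterThan_0_LIMSEQ:
  fixes h :: "real \<Rightarrow> ennreal"
  assumes [measurable]: "h \<in> borel_measurable borel"
  shows "(\<lambda>n. \<integral>\<^sup>+x. h x * indicator {inverse (real (Suc n))..} x \<partial>lborel)
    \<longlonglongrightarrow> (\<integral>\<^sup>+x. h x * indicator {0<..} x \<partial>lborel)"
proof (rule nn_integral_LIMSEQ)
  show "incseq (\<lambda>n x. h x * indicator {inverse (real (Suc n))..} x)"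
  proof (intro incseq_SucI le_funI)
    fix n and x :: real
    have "inverse (real (Suc (Suc n))) \<le> inverse (real (Suc n))"
      by (intro le_imp_inverse_le) auto
    then have "{inverse (real (Suc n))..} \<subseteq> {inverse (real (Suc (Suc n)))..}"
      by (simp only: atLeast_subset_iff)
    then show "h x * indicator {inverse (real (Suc n))..} x \<le>
        h x * indicator {inverse (real (Suc (Suc n)))..} x"
      by (intro mult_left_mono indicator_leI) (erule (1) subsetD, simp)
  qed
  show "(\<lambda>n. h x * indicator {inverse (real (Suc n))..} x) \<longlonglongrightarrow> h x * indicator {0<..} x" for x
  proof (rule tendsto_eventually, cases "x > 0")
    case True
    then obtain N where N: "inverse (real (Suc N)) < x"
      using reals_Archimedean by blast
    have "inverse (real (Suc n)) \<le> x" if "n \<ge> N" for n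
      using le_imp_inverse_le[of "real (Suc N)" "real (Suc n)"] N that by linarith
    then show "\<forall>\<^sub>F n in sequentially.
        h x * indicator {inverse (real (Suc n))..} x = h x * indicator {0<..} x"
      using True by (intro eventually_sequentiallyI[of N]) simp
  next
    case False
    have "\<not> inverse (real (Suc n)) \<le> x" for n
      using False by (metis inverse_positive_iff_positive less_le_trans of_nat_0_less_iff zero_less_Suc)
    then show "\<forall>\<^sub>F n in sequentially.
        h x * indicator {inverse (real (Suc n))..} x = h x * indicator {0<..} x"
      using False by (intro always_eventually allI) simp
  qed
qed measurable

text \<open>A criterion of Polya type, free of Gaussian processes: a convex decreasing function with
  finite slope at 0 and limit 0 is the covariance built from \<open>g = c'' / D\<close>, because the
  tail of \<open>g\<close> is - c' / D and integrates to (1 - c(s)) / D over [0, s].\<close>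

lemma switching_density_of_convex_covariance:
  fixes c c' c'' :: "real \<Rightarrow> real"
  assumes c: "\<And>t. t > 0 \<Longrightarrow> (c has_real_derivative c' t) (at t)"
    and c': "\<And>t. t > 0 \<Longrightarrow> (c' has_real_derivative c'' t) (at t)"
    and c'_le: "\<And>t. t > 0 \<Longrightarrow> c' t \<le> 0" and c'_ge: "\<And>t. t > 0 \<Longrightarrow> - K \<le> c' t"
    and c''_ge: "\<And>t. t > 0 \<Longrightarrow> 0 \<le> c'' t"
    and c''_le: "\<And>t. t > 0 \<Longrightarrow> c'' t \<le> L * (1 + 1 / t)" and L: "0 \<le> L"
    and c_0: "c 0 = 1" and c_lim_0: "(c \<longlongrightarrow> 1) (at_right 0)" and c_lim: "(c \<longlongrightarrow> 0) at_top"
  shows "\<exists>f. switching_density f \<and> switching_dist f \<in> GD 2 \<and> (\<forall>t. switch_covariance f t = c \<bar>t\<bar>)"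
proof -
  have c'_mono: "c' s \<le> c' t" if "0 < s" "s \<le> t" for s t
  proof (rule DERIV_nonneg_imp_nondecreasing[OF that(2)])
    fix x
    assume "s \<le> x"
    then show "\<exists>y. DERIV c' x :> y \<and> 0 \<le> y"
      using that c'[of x] c''_ge[of x] by (intro exI[of _ "c'' x"]) auto
  qed
  have c_anti: "c t \<le> c s" if "0 < s" "s \<le> t" for s t
  proof (rule DERIV_nonpos_imp_nonincreasing[OF that(2)])
    fix x
    assume "s \<le> x"
    then show "\<exists>y. DERIV c x :> y \<and> y \<le> 0"
      using that c[of x] c'_le[of x] by (intro exI[of _ "c' x"]) auto
  qed
  have c_nonneg: "0 \<le> c t" if "0 < t" for t
    using tendsto_upperbound[OF c_lim, of "c t"] that c_anti
    by (auto intro: eventually_at_top_linorderI[of t])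
  have c_le_1: "c t \<le> 1" if "0 < t" for t
  proof (rule tendsto_lowerbound[OF c_lim_0])
    show "\<forall>\<^sub>F s in at_right 0. c t \<le> c s"
      using that c_anti by (auto simp: eventually_at_right intro!: exI[of _ t])
  qed simp
  \<comment> \<open>By convexity, t / 2 times - c'(t) is at most the drop of c over [t / 2, t], and
    this drop is at most 1.\<close>
  have c'_lim: "(c' \<longlongrightarrow> 0) at_top"
  proof (rule tendsto_sandwich)
    show "\<forall>\<^sub>F t in at_top. - (2 / t) \<le> c' t"
    proof (rule eventually_at_top_linorderI[of 1])
      fix t :: real
      assume t: "1 \<le> t"
      then obtain \<xi> where \<xi>: "t / 2 < \<xi>" "\<xi> < t" "c t - c (t / 2) = (t - t / 2) * c' \<xi>"
        using MVT2[of "t / 2" t c c'] c by auto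
      have "c' \<xi> * (t / 2) \<le> c' t * (t / 2)"
        using t \<xi> by (intro mult_right_mono c'_mono) auto
      moreover have "c' \<xi> * (t / 2) = c t - c (t / 2)"
        using \<xi>(3) by (simp add: mult.commute)
      ultimately have "- 1 \<le> c' t * (t / 2)"
        using t c_nonneg[of t] c_le_1[of "t / 2"] by linarith
      then show "- (2 / t) \<le> c' t"
        using t by (simp add: field_simps)
    qed
    show "((\<lambda>t :: real. - (2 / t)) \<longlongrightarrow> 0) at_top"
      by real_asymp
    show "\<forall>\<^sub>F t in at_top. c' t \<le> 0"
      using c'_le by (auto intro: eventually_at_top_linorderI[of 1])
  qed simp
  define h where "h x = (if x \<in> {0<..} then c'' x else 0)" for x
  define k where "k x = (if x \<in> {0<..} then - c' x else 0)" for x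
  have [measurable]: "h \<in> borel_measurable borel"
    unfolding h_def by (rule borel_measurable_derivative_greaterThan[OF c'])
  have [measurable]: "k \<in> borel_measurable borel"
    unfolding k_def by (rule borel_measurable_derivative_greaterThan(1)[OF DERIV_minus[OF c']])
  have h_nonneg: "0 \<le> h x" and k_nonneg: "0 \<le> k x" for x
    using c''_ge c'_le by (auto simp: h_def k_def)
  have h_tail: "(\<integral>\<^sup>+x. ennreal (h x) * indicator {a..} x \<partial>lborel) = ennreal (- c' a)" if "0 < a" for a
  proof -
    have "(c' has_real_derivative h x) (at x)" if "a \<le> x" for x
      using c'[of x] that \<open>0 < a\<close> by (simp add: h_def)
    from nn_integral_FTC_atLeast[OF _ this h_nonneg c'_lim] show ?thesis
      by simp
  qed
  have k_tail: "(\<integral>\<^sup>+x. ennreal (k x) * indicator {a..} x \<partial>lborel) = ennreal (c a)" if "0 < a" for a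
  proof -
    have "((\<lambda>x. - c x) has_real_derivative k x) (at x)" if "a \<le> x" for x
      using DERIV_minus[OF c[of x]] that \<open>0 < a\<close> by (simp add: k_def)
    from nn_integral_FTC_atLeast[OF _ this k_nonneg tendsto_minus[OF c_lim]] show ?thesis
      by simp
  qed
  have h_pos: "ennreal (h x) * indicator {0<..} x = ennreal (h x)"
    and k_pos: "ennreal (k x) * indicator {0<..} x = ennreal (k x)" for x
    by (auto simp: h_def k_def)
  have k_total: "(\<integral>\<^sup>+x. ennreal (k x) \<partial>lborel) = 1"
  proof (rule LIMSEQ_unique)
    show "(\<lambda>n. ennreal (c (inverse (real (Suc n))))) \<longlonglongrightarrow> (\<integral>\<^sup>+x. ennreal (k x) \<partial>lborel)"
      using nn_integral_greaterThan_0_LIMSEQ[of "\<lambda>x. ennreal (k x)"] by (simp add: k_pos k_tail)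
    have "filterlim (\<lambda>n. inverse (real (Suc n))) (at_right 0) sequentially"
      using LIMSEQ_inverse_real_of_nat by (auto simp: filterlim_at)
    from tendsto_ennrealI[OF filterlim_compose[OF c_lim_0 this]]
    show "(\<lambda>n. ennreal (c (inverse (real (Suc n))))) \<longlonglongrightarrow> 1"
      by simp
  qed
  have h_total_le: "(\<integral>\<^sup>+x. ennreal (h x) \<partial>lborel) \<le> ennreal K"
  proof (rule LIMSEQ_le_const2)
    show "(\<lambda>n. ennreal (- c' (inverse (real (Suc n))))) \<longlonglongrightarrow> (\<integral>\<^sup>+x. ennreal (h x) \<partial>lborel)"
      using nn_integral_greaterThan_0_LIMSEQ[of "\<lambda>x. ennreal (h x)"] by (simp add: h_pos h_tail)
    have "- c' (inverse (real (Suc n))) \<le> K" for n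
      using c'_ge[of "inverse (real (Suc n))"] by simp
    then show "\<exists>N. \<forall>n\<ge>N. ennreal (- c' (inverse (real (Suc n)))) \<le> ennreal K"
      by (auto intro: ennreal_leI)
  qed
  \<comment> \<open>The total mass of c'' is - c'(0+), obtained as a limit of \<open>h_tail\<close>;
    \<open>K\<close> keeps it finite.\<close>
  define D where "D = enn2real (\<integral>\<^sup>+x. ennreal (h x) \<partial>lborel)"
  have D_eq: "(\<integral>\<^sup>+x. ennreal (h x) \<partial>lborel) = ennreal D"
    using le_less_trans[OF h_total_le ennreal_less_top] by (simp add: D_def)
  \<comment> \<open>Otherwise c' would vanish, although - c' has total mass 1.\<close>
  have "D \<noteq> 0"
  proof
    assume "D = 0"
    have "c' a = 0" if "0 < a" for a
    proof -
      have "(\<integral>\<^sup>+x. ennreal (h x) * indicator {a..} x \<partial>lborel) \<le> (\<integral>\<^sup>+x. ennreal (h x) \<partial>lborel)"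
        by (intro nn_integral_mono) (auto split: split_indicator)
      then show ?thesis
        using that \<open>D = 0\<close> c'_le[OF that] by (simp add: D_eq h_tail)
    qed
    then have "ennreal (k x) = 0" for x
      by (simp add: k_def)
    then show False
      using k_total by simp
  qed
  then have D: "D > 0"
    by (simp add: D_def less_le)
  define g where "g x = ennreal (h x / D)" for x
  have [measurable]: "g \<in> borel_measurable borel"
    unfolding g_def by measurable
  have g_eq: "g x = ennreal (h x) / ennreal D" for x
    using D h_nonneg by (simp add: g_def divide_ennreal)
  have tail_g: "tail_of g a = ennreal (k a) / ennreal D" if "a \<noteq> 0" for a
  proof (cases "0 < a")
    case True
    have "(\<integral>\<^sup>+x. g x * indicator {a<..} x \<partial>lborel) =
        (\<integral>\<^sup>+x. ennreal (h x) * indicator {a..} x / ennreal D \<partial>lborel)"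
    proof (rule nn_integral_cong_AE)
      show "AE x in lborel. g x * indicator {a<..} x = ennreal (h x) * indicator {a..} x / ennreal D"
        using AE_lborel_singleton[of a]
        by (rule eventually_mono) (auto simp: g_eq split: split_indicator)
    qed
    also have "\<dots> = ennreal (- c' a) / ennreal D"
      using True by (subst nn_integral_divide) (auto simp: h_tail)
    finally show ?thesis
      using True by (simp add: tail_of_def k_def)
  next
    case False
    then show ?thesis
      using that by (simp add: tail_of_def k_def)
  qed
  have tail_total: "(\<integral>\<^sup>+u. tail_of g u \<partial>lborel) = ennreal (1 / D)"
  proof -
    have "(\<integral>\<^sup>+u. tail_of g u \<partial>lborel) = (\<integral>\<^sup>+u. ennreal (k u) / ennreal D \<partial>lborel)"
      using AE_lborel_singleton[of 0]
      by (intro nn_integral_cong_AE) (auto elim!: eventually_mono simp: tail_g)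
    also have "\<dots> = 1 / ennreal D"
      by (simp add: nn_integral_divide k_total)
    finally show ?thesis
      using D by (simp add: divide_ennreal[of 1, simplified])
  qed
  have tail_upto: "enn2real (\<integral>\<^sup>+u. tail_of g u * indicator {..s} u \<partial>lborel) = (1 - c s) / D"
    if "0 \<le> s" for s
  proof (cases "s = 0")
    case True
    have "(\<integral>\<^sup>+u. tail_of g u * indicator {..s} u \<partial>lborel) = (\<integral>\<^sup>+u. 0 \<partial>(lborel :: real measure))"
      using AE_lborel_singleton[of 0] True
      by (intro nn_integral_cong_AE) (auto elim!: eventually_mono simp: tail_of_def split: split_indicator)
    then show ?thesis
      using True c_0 by simp
  next
    case False
    with that have s: "0 < s"
      by simp
    \<comment> \<open>The part beyond \<open>s\<close> is known to be \<open>c s / D\<close>, so the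
      part up to \<open>s\<close> is found as its complement in the total
      \<open>1 / D\<close>.\<close>
    have "(\<integral>\<^sup>+u. tail_of g u * indicator {..s} u \<partial>lborel) +
        (\<integral>\<^sup>+u. ennreal (k u) * indicator {s..} u / ennreal D \<partial>lborel) =
        (\<integral>\<^sup>+u. tail_of g u * indicator {..s} u + ennreal (k u) * indicator {s..} u / ennreal D \<partial>lborel)"
      by (intro nn_integral_add[symmetric]) measurable
    also have "\<dots> = (\<integral>\<^sup>+u. tail_of g u \<partial>lborel)"
      using AE_lborel_singleton[of 0] AE_lborel_singleton[of s]
      by (intro nn_integral_cong_AE)
        (auto elim!: eventually_elim2 simp: tail_g split: split_indicator)
    also have "(\<integral>\<^sup>+u. ennreal (k u) * indicator {s..} u / ennreal D \<partial>lborel) = ennreal (c s / D)"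
      using s D c_nonneg[OF s] by (subst nn_integral_divide) (auto simp: k_tail divide_ennreal)
    finally have sum: "(\<integral>\<^sup>+u. tail_of g u * indicator {..s} u \<partial>lborel) + ennreal (c s / D) = ennreal (1 / D)"
      by (simp add: tail_total)
    then have "(\<integral>\<^sup>+u. tail_of g u * indicator {..s} u \<partial>lborel) \<noteq> top"
      by auto
    then obtain z where z: "(\<integral>\<^sup>+u. tail_of g u * indicator {..s} u \<partial>lborel) = ennreal z" "0 \<le> z"
      by (metis ennreal_cases)
    then have "ennreal (z + c s / D) = ennreal (1 / D)"
      using sum D c_nonneg[OF s] by simp
    then have "z + c s / D = 1 / D"
      using z D c_nonneg[OF s] by (subst (asm) ennreal_inj) auto
    then show ?thesis
      using z by (simp add: diff_divide_distrib)
  qed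
  interpret thinned_renewal g "L / D"
  proof
    show "(\<integral>\<^sup>+x. g x \<partial>lborel) = 1"
      using D by (simp add: g_eq nn_integral_divide D_eq divide_ennreal)
    show "g x \<le> ennreal (L / D * (1 + 1 / x))" if "x > 0" for x
      using that c''_le[OF that] D unfolding g_def
      by (intro ennreal_leI) (simp add: h_def divide_right_mono)
    show "(\<integral>\<^sup>+u. tail_of g u \<partial>lborel) < \<infinity>"
      by (simp add: tail_total)
  qed (use L D in \<open>auto simp: g_def h_def\<close>)
  have "switch_covariance f t = c \<bar>t\<bar>" for t
    using D by (simp add: switch_covariance_eq tail_upto tail_total)
  then show ?thesis
    using switching_density_f switching_dist_in_GD by blast
qed

section \<open>The covariance of the clipped Gaussian process\<close>

text \<open>Only one application of l'Hopital is possible, since r' is differentiable merely at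
  \<open>t\<close> itself. The remaining symmetric quotient of r' is the average of a forward and a
  backward difference quotient.\<close>

lemma symmetric_second_difference_quotient:
  fixes r r' :: "real \<Rightarrow> real"
  assumes "\<delta> > 0" and r: "\<And>x. \<bar>x - t\<bar> < \<delta> \<Longrightarrow> (r has_real_derivative r' x) (at x)"
    and r': "(r' has_real_derivative d) (at t)"
  shows "((\<lambda>h. (r (t + h) + r (t - h) - 2 * r t) / h\<^sup>2) \<longlongrightarrow> d) (at_right 0)"
proof (rule lhopital_right_0[where f' = "\<lambda>h. r' (t + h) - r' (t - h)" and g' = "\<lambda>h. 2 * h"])
  have near: "\<forall>\<^sub>F h in at_right 0. 0 < h \<and> h < \<delta>"
    using \<open>\<delta> > 0\<close> by (auto simp: eventually_at_right)
  have "isCont r t"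
    using r[of t] \<open>\<delta> > 0\<close> by (auto intro: DERIV_isCont)
  then have "((\<lambda>h. r (t + h) + r (t - h) - 2 * r t) \<longlongrightarrow> r (t + 0) + r (t - 0) - 2 * r t) (at_right 0)"
    by (intro tendsto_intros isCont_tendsto_compose[of "t + 0" r] isCont_tendsto_compose[of "t - 0" r]) auto
  then show "((\<lambda>h. r (t + h) + r (t - h) - 2 * r t) \<longlongrightarrow> 0) (at_right 0)"
    by simp
  show "((\<lambda>h. h\<^sup>2) \<longlongrightarrow> 0) (at_right (0 :: real))"
    by real_asymp
  show "\<forall>\<^sub>F h in at_right 0. h\<^sup>2 \<noteq> (0 :: real)" "\<forall>\<^sub>F h in at_right 0. 2 * h \<noteq> (0 :: real)"
    using near by (auto elim!: eventually_mono)
  show "\<forall>\<^sub>F h in at_right 0. ((\<lambda>h. r (t + h) + r (t - h) - 2 * r t) has_real_derivative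
      r' (t + h) - r' (t - h)) (at h)"
    using near
  proof (rule eventually_mono)
    fix h
    assume h: "0 < h \<and> h < \<delta>"
    have "((\<lambda>h. r (t + h)) has_real_derivative r' (t + h) * (0 + 1)) (at h)"
      using h by (intro DERIV_chain2[of r] r derivative_intros) auto
    moreover have "((\<lambda>h. r (t - h)) has_real_derivative r' (t - h) * (0 - 1)) (at h)"
      using h by (intro DERIV_chain2[of r] r derivative_intros) auto
    ultimately show "((\<lambda>h. r (t + h) + r (t - h) - 2 * r t) has_real_derivative r' (t + h) - r' (t - h)) (at h)"
      by (auto intro!: derivative_eq_intros)
  qed
  show "\<forall>\<^sub>F h in at_right 0. ((\<lambda>h. h\<^sup>2) has_real_derivative 2 * h) (at h)"
    by (intro always_eventually allI) (auto intro!: derivative_eq_intros)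
  have lim: "((\<lambda>h. (r' (t + h) - r' t) / h) \<longlongrightarrow> d) (at 0)"
    using r' by (simp add: DERIV_def)
  then have "((\<lambda>h. (r' (t + - h) - r' t) / - h) \<longlongrightarrow> d) (at_right 0)"
    by (rule filterlim_compose) (auto simp: filterlim_at intro!: tendsto_eq_intros eventually_mono[OF near])
  moreover have "((\<lambda>h. (r' (t + h) - r' t) / h) \<longlongrightarrow> d) (at_right 0)"
    using lim by (rule tendsto_mono[rotated]) (simp add: at_le)
  ultimately have "((\<lambda>h. ((r' (t + h) - r' t) / h + (r' (t + - h) - r' t) / - h) / 2) \<longlongrightarrow> (d + d) / 2) (at_right 0)"
    by (intro tendsto_intros) auto
  moreover have eq: "((r' (t + h) - r' t) / h + (r' (t + - h) - r' t) / - h) / 2 =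
      (r' (t + h) - r' (t - h)) / (2 * h)" for h
    by (cases "h = 0") (auto simp: field_simps)
  ultimately show "((\<lambda>h. (r' (t + h) - r' (t - h)) / (2 * h)) \<longlongrightarrow> d) (at_right 0)"
    unfolding eq by simp
qed

text \<open>A crude constant suffices: up to \<open>pi / 3\<close> the cosine is at least 1/2, which
  even gives the factor 2; beyond it the sine is at least 1/2 while \<open>x\<close> is below
  2.\<close>

lemma le_4_sin:
  assumes "0 \<le> x" "x \<le> pi / 2"
  shows "x \<le> 4 * sin x"
proof (cases "x \<le> pi / 3")
  case True
  show ?thesis
  proof (cases "x = 0")
    case False
    with assms obtain z where z: "0 < z" "z < x" "sin x - sin 0 = (x - 0) * cos z"
      using MVT2[of 0 x sin cos] DERIV_sin by auto
    have "1 / 2 \<le> cos z"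
      using z True cos_monotone_0_pi_le[of z "pi / 3"] by (simp add: cos_60)
    from mult_left_mono[OF this assms(1)] show ?thesis
      using z assms by simp
  qed simp
next
  case False
  then have "1 / 2 \<le> sin x"
    using sin_monotone_2pi_le[of "pi / 6" x] assms by (simp add: sin_30)
  then show ?thesis
    using assms pi_less_4 by linarith
qed

text \<open>
  The expected product of the increments \<open>Z (t + h) - Z t\<close> and \<open>Z h - Z 0\<close> is a second difference
  of \<open>r\<close>, and both increments have variance \<open>2 - 2 r(h)\<close>.
\<close>

lemma covariance_second_difference:
  fixes Z :: "real \<Rightarrow> 'w \<Rightarrow> real"
  assumes [measurable]: "\<And>t. Z t \<in> borel_measurable M"
    and cov: "\<And>s t. (\<integral>\<omega>. Z (s + t) \<omega> * Z s \<omega> \<partial>M) = r t" and r_0: "r 0 = 1"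
  shows "\<bar>2 * r t - r (t + h) - r (t - h)\<bar> \<le> 2 - 2 * r h" and "r (- t) = r t"
proof -
  \<comment> \<open>A square that is not integrable would have Bochner integral 0, whereas the
    integral is \<open>r 0 = 1\<close>.\<close>
  have sq: "integrable M (\<lambda>\<omega>. (Z s \<omega>)\<^sup>2)" for s
  proof (rule ccontr)
    assume "\<not> ?thesis"
    then show False
      using cov[of s 0] r_0 not_integrable_integral_eq[of M "\<lambda>\<omega>. (Z s \<omega>)\<^sup>2"]
      by (simp add: power2_eq_square)
  qed
  have int: "integrable M (\<lambda>\<omega>. Z s \<omega> * Z t \<omega>)" for s t
  proof (rule Bochner_Integration.integrable_bound)
    show "integrable M (\<lambda>\<omega>. (Z s \<omega>)\<^sup>2 + (Z t \<omega>)\<^sup>2)"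
      using sq by simp
    have "\<bar>a * b\<bar> \<le> a\<^sup>2 + b\<^sup>2" for a b :: real
    proof -
      have "2 * \<bar>a\<bar> * \<bar>b\<bar> \<le> \<bar>a\<bar>\<^sup>2 + \<bar>b\<bar>\<^sup>2"
        by (rule sum_squares_bound)
      moreover have "0 \<le> \<bar>a\<bar> * \<bar>b\<bar>"
        by simp
      ultimately show ?thesis
        unfolding abs_mult power2_abs by linarith
    qed
    then show "AE \<omega> in M. norm (Z s \<omega> * Z t \<omega>) \<le> norm ((Z s \<omega>)\<^sup>2 + (Z t \<omega>)\<^sup>2)"
      by simp
  qed measurable
  have cov': "(\<integral>\<omega>. Z s \<omega> * Z t \<omega> \<partial>M) = r (s - t)" for s t
    using cov[of t "s - t"] by simp
  have sym: "r (- t) = r t" for t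
    using cov'[of 0 t] cov'[of t 0] by (simp add: mult.commute)
  then show "r (- t) = r t" .
  have incr: "integrable M (\<lambda>\<omega>. (Z (s + h) \<omega> - Z s \<omega>)\<^sup>2)"
    "(\<integral>\<omega>. (Z (s + h) \<omega> - Z s \<omega>)\<^sup>2 \<partial>M) = 2 - 2 * r h" for s
  proof -
    have eq: "(Z (s + h) \<omega> - Z s \<omega>)\<^sup>2 = Z (s + h) \<omega> * Z (s + h) \<omega> + Z s \<omega> * Z s \<omega> - 2 * (Z (s + h) \<omega> * Z s \<omega>)" for \<omega>
      by (simp add: power2_eq_square algebra_simps)
    show "integrable M (\<lambda>\<omega>. (Z (s + h) \<omega> - Z s \<omega>)\<^sup>2)"
      unfolding eq using int by simp
    show "(\<integral>\<omega>. (Z (s + h) \<omega> - Z s \<omega>)\<^sup>2 \<partial>M) = 2 - 2 * r h"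
      unfolding eq using int by (simp add: cov' r_0)
  qed
  define U where "U \<omega> = Z (t + h) \<omega> - Z t \<omega>" for \<omega>
  define V where "V \<omega> = Z (0 + h) \<omega> - Z 0 \<omega>" for \<omega>
  have UV: "U \<omega> * V \<omega> = Z (t + h) \<omega> * Z h \<omega> - Z (t + h) \<omega> * Z 0 \<omega> - Z t \<omega> * Z h \<omega> + Z t \<omega> * Z 0 \<omega>" for \<omega>
    by (simp add: U_def V_def algebra_simps)
  have "2 * r t - r (t + h) - r (t - h) = (\<integral>\<omega>. U \<omega> * V \<omega> \<partial>M)"
    unfolding UV using int by (simp add: cov')
  also have "\<bar>\<dots>\<bar> \<le> (\<integral>\<omega>. \<bar>U \<omega> * V \<omega>\<bar> \<partial>M)"
    by (rule integral_abs_bound)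
  also have "\<dots> \<le> (\<integral>\<omega>. ((U \<omega>)\<^sup>2 + (V \<omega>)\<^sup>2) / 2 \<partial>M)"
  proof (rule integral_mono)
    show "integrable M (\<lambda>\<omega>. \<bar>U \<omega> * V \<omega>\<bar>)"
      unfolding UV using int by (intro integrable_abs) simp
    show "integrable M (\<lambda>\<omega>. ((U \<omega>)\<^sup>2 + (V \<omega>)\<^sup>2) / 2)"
      using incr(1)[of t] incr(1)[of 0] unfolding U_def V_def by simp
    fix \<omega>
    show "\<bar>U \<omega> * V \<omega>\<bar> \<le> ((U \<omega>)\<^sup>2 + (V \<omega>)\<^sup>2) / 2"
      using sum_squares_bound[of "\<bar>U \<omega>\<bar>" "\<bar>V \<omega>\<bar>"] by (simp add: abs_mult)
  qed
  also have "\<dots> = 2 - 2 * r h"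
    using incr[of t] incr[of 0] by (simp add: U_def V_def)
  finally show "\<bar>2 * r t - r (t + h) - r (t - h)\<bar> \<le> 2 - 2 * r h" .
qed

theorem proposition9:
  fixes M :: "'w measure" and Z :: "real \<Rightarrow> 'w \<Rightarrow> real" and r r' r'' :: "real \<Rightarrow> real"
  assumes gauss: "gaussian_process M Z" and stat: "stationary_process M Z"
    and mean: "\<And>t. (\<integral>\<omega>. Z t \<omega> \<partial>M) = 0"
    and cov: "\<And>s t. covariance M (Z (s + t)) (Z s) = r t"
    and unit_var: "r 0 = 1"
    and deriv1: "\<And>t. t > 0 \<Longrightarrow> (r has_real_derivative r' t) (at t)"
    and deriv2: "\<And>t. t > 0 \<Longrightarrow> (r' has_real_derivative r'' t) (at t)"
    and i: "\<And>t. t > 0 \<Longrightarrow> r t \<ge> 0"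
    and ii: "\<And>t. t > 0 \<Longrightarrow> r' t \<le> 0"
    and iii: "\<And>t. t > 0 \<Longrightarrow> r'' t \<ge> - ((r' t)\<^sup>2 * r t / (1 - (r t)\<^sup>2))"
    \<comment> \<open>Necessary for the conclusion and not implied by the above: finite second spectral moment
       (mean-square differentiability of \<open>Z\<close>), and vanishing correlation at infinity.\<close>
    and spectral: "(\<lambda>t. 1 - r t) \<in> O[at_right 0](\<lambda>t. t\<^sup>2)"
    and decay: "(r \<longlongrightarrow> 0) at_top"
  shows "\<exists>f. switching_density f \<and> switching_dist f \<in> GD 2 \<and>
           (\<forall>t. switch_covariance f t = 2 / pi * arcsin (r t))"
proof -
  have Z_meas: "Z t \<in> borel_measurable M" for t
  proof -
    have "normal_rv M (\<lambda>\<omega>. \<Sum>s\<in>{t}. 1 * Z s \<omega>)"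
      using gauss[unfolded gaussian_process_def, THEN conjunct2, rule_format, of "{t}" "\<lambda>_. 1"]
      by simp
    then show ?thesis
      by (simp add: normal_rv_def)
  qed
  have cov': "(\<integral>\<omega>. Z (s + t) \<omega> * Z s \<omega> \<partial>M) = r t" for s t
    using cov[of s t] by (simp add: covariance_def mean)
  note second_difference = covariance_second_difference(1)[OF Z_meas cov' unit_var]
  note r_minus = covariance_second_difference(2)[OF Z_meas cov' unit_var]
  have r_le_1: "r t \<le> 1" for t
    using second_difference[of 0 t] by linarith
  \<comment> \<open>If \<open>r h = 1\<close>, the second difference inequality forces all second
    differences of step \<open>h\<close> to vanish. Starting from \<open>r 0 = r h = 1\<close>, r
    then equals 1 at all multiples of \<open>h\<close>, contrary to the decay.\<close>
  have r_less_1: "r h < 1" if h: "0 < h" for h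
  proof (rule ccontr)
    assume "\<not> r h < 1"
    with r_le_1[of h] have r_h: "r h = 1"
      by simp
    have step: "r (t + h) = 2 * r t - r (t - h)" for t
      using second_difference[of t h] r_h by linarith
    have periodic: "r (real n * h) = 1 \<and> r (real (Suc n) * h) = 1" for n
    proof (induction n)
      case (Suc n)
      have "real (Suc (Suc n)) * h = real (Suc n) * h + h" "real (Suc n) * h - h = real n * h"
        by (simp_all add: algebra_simps)
      then show ?case
        using Suc step[of "real (Suc n) * h"] by simp
    qed (use unit_var r_h in simp)
    have "filterlim (\<lambda>n. real n * h) at_top sequentially"
      using h by real_asymp
    from filterlim_compose[OF decay this] have "(\<lambda>n. 1 :: real) \<longlonglongrightarrow> 0"
      using periodic by simp
    then show False
      by (simp add: LIMSEQ_const_iff)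
  qed
  have r_anti: "r t \<le> r s" if "0 < s" "s \<le> t" for s t
  proof (rule DERIV_nonpos_imp_nonincreasing[OF that(2)])
    fix x
    assume "s \<le> x"
    then show "\<exists>y. DERIV r x :> y \<and> y \<le> 0"
      using that deriv1[of x] ii[of x] by (intro exI[of _ "r' x"]) auto
  qed
  obtain K where K: "0 < K" "\<forall>\<^sub>F t in at_right 0. norm (1 - r t) \<le> K * norm (t\<^sup>2)"
    using spectral by (auto elim: landau_o.bigE)
  then obtain \<epsilon> where \<epsilon>: "0 < \<epsilon>" and "\<forall>t>0. t < \<epsilon> \<longrightarrow> norm (1 - r t) \<le> K * norm (t\<^sup>2)"
    by (auto simp: eventually_at_right)
  then have K_le: "1 - r t \<le> K * t\<^sup>2" if "0 < t" "t < \<epsilon>" for t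
    using that by (fastforce dest: spec[of _ t])
  have r''_le: "\<bar>r'' t\<bar> \<le> 2 * K" if t: "0 < t" for t
  proof (rule tendsto_upperbound)
    show "((\<lambda>h. \<bar>(r (t + h) + r (t - h) - 2 * r t) / h\<^sup>2\<bar>) \<longlongrightarrow> \<bar>r'' t\<bar>) (at_right 0)"
      using t by (intro tendsto_rabs symmetric_second_difference_quotient[of t t r r'] deriv1 deriv2) auto
    have "\<bar>(r (t + h) + r (t - h) - 2 * r t) / h\<^sup>2\<bar> \<le> 2 * K" if "0 < h" "h < \<epsilon>" for h
    proof -
      have "\<bar>r (t + h) + r (t - h) - 2 * r t\<bar> \<le> 2 * K * h\<^sup>2"
        using second_difference[of t h] K_le[OF that] by linarith
      then show ?thesis
        using that by (simp add: divide_le_eq)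
    qed
    then show "\<forall>\<^sub>F h in at_right 0. \<bar>(r (t + h) + r (t - h) - 2 * r t) / h\<^sup>2\<bar> \<le> 2 * K"
      using \<epsilon> by (auto simp: eventually_at_right intro!: exI[of _ \<epsilon>])
  qed simp
  have r_lim_0: "(r \<longlongrightarrow> 1) (at_right 0)"
  proof (rule tendsto_sandwich)
    show "\<forall>\<^sub>F t in at_right 0. 1 - K * t\<^sup>2 \<le> r t"
      using K_le \<epsilon> by (auto simp: eventually_at_right algebra_simps intro!: exI[of _ \<epsilon>])
    show "((\<lambda>t. 1 - K * t\<^sup>2) \<longlongrightarrow> 1) (at_right 0)"
      by real_asymp
  qed (use r_le_1 in auto)
  define q where "q t = sqrt (1 - (r t)\<^sup>2)" for t
  define c where "c t = 2 / pi * arcsin (r t)" for t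
  define c' where "c' t = 2 / pi * (r' t / q t)" for t
  define c'' where "c'' t = 2 / pi * ((r'' t + (r' t)\<^sup>2 * r t / (1 - (r t)\<^sup>2)) / q t)" for t
  have r_sq: "0 < 1 - (r t)\<^sup>2" if "0 < t" for t
    using i[OF that] r_less_1[OF that] by (simp add: power_less_one_iff abs_square_less_1)
  have q_pos: "0 < q t" and q_sq: "(q t)\<^sup>2 = 1 - (r t)\<^sup>2" if "0 < t" for t
    using r_sq[OF that] by (simp_all add: q_def)
  have c_deriv: "(c has_real_derivative c' t) (at t)" if t: "0 < t" for t
  proof -
    have "((\<lambda>t. arcsin (r t)) has_real_derivative inverse (sqrt (1 - (r t)\<^sup>2)) * r' t) (at t)"
      using i[OF t] r_less_1[OF t] by (intro DERIV_chain2[OF DERIV_arcsin] deriv1 t) auto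
    then show ?thesis
      unfolding c_def c'_def q_def by (intro DERIV_cmult) (simp add: field_simps)
  qed
  have c'_deriv: "(c' has_real_derivative c'' t) (at t)" if t: "0 < t" for t
  proof -
    have "((\<lambda>t. 1 - (r t)\<^sup>2) has_real_derivative - (2 * r t * r' t)) (at t)"
      using deriv1[OF t] by (auto intro!: derivative_eq_intros)
    from DERIV_chain2[OF DERIV_real_sqrt[OF r_sq[OF t]] this]
    have "(q has_real_derivative - (r t * r' t / q t)) (at t)"
      using q_pos[OF t] by (simp add: q_def[abs_def] field_simps)
    with deriv2[OF t]
    have "((\<lambda>t. r' t / q t) has_real_derivative (r'' t * q t - r' t * - (r t * r' t / q t)) / (q t * q t)) (at t)"
      using q_pos[OF t] by (intro DERIV_divide) auto
    also have "(r'' t * q t - r' t * - (r t * r' t / q t)) / (q t * q t) =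
        (r'' t + (r' t)\<^sup>2 * r t / (q t)\<^sup>2) / q t"
      using q_pos[OF t] by (simp add: field_simps power2_eq_square)
    finally show ?thesis
      unfolding c'_def c''_def q_sq[OF t, symmetric] by (rule DERIV_cmult)
  qed
  have c'_le: "c' t \<le> 0" if "0 < t" for t
    using ii[OF that] q_pos[OF that] by (auto simp: c'_def mult_le_0_iff divide_le_0_iff)
  have c''_ge: "0 \<le> c'' t" if "0 < t" for t
    using iii[OF that] q_pos[OF that] by (auto simp: c''_def)
  have c'_mono: "c' s \<le> c' t" if "0 < s" "s \<le> t" for s t
  proof (rule DERIV_nonneg_imp_nondecreasing[OF that(2)])
    fix x
    assume "s \<le> x"
    then show "\<exists>y. DERIV c' x :> y \<and> 0 \<le> y"
      using that c'_deriv[of x] c''_ge[of x] by (intro exI[of _ "c'' x"]) auto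
  qed
  have c_0: "c 0 = 1"
    by (simp add: c_def unit_var)
  have c_lim_0: "(c \<longlongrightarrow> 1) (at_right 0)"
  proof -
    have "\<forall>\<^sub>F t in at_right 0. r t \<in> {-1..1}"
      using eventually_at_right_less[of 0]
      by (rule eventually_mono) (use r_le_1 i in \<open>auto intro: order_trans[of _ 0]\<close>)
    then have "((\<lambda>t. arcsin (r t)) \<longlongrightarrow> arcsin 1) (at_right 0)"
      using r_lim_0 by (intro continuous_on_tendsto_compose[OF continuous_on_arcsin']) auto
    then have "(c \<longlongrightarrow> 2 / pi * arcsin 1) (at_right 0)"
      unfolding c_def by (rule tendsto_mult_left)
    then show ?thesis
      by simp
  qed
  have c_lim: "(c \<longlongrightarrow> 0) at_top"
  proof -
    have "((\<lambda>t. arcsin (r t)) \<longlongrightarrow> arcsin 0) at_top"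
      by (rule isCont_tendsto_compose[OF isCont_arcsin decay]) auto
    then have "(c \<longlongrightarrow> 2 / pi * arcsin 0) at_top"
      unfolding c_def by (rule tendsto_mult_left)
    then show ?thesis
      by simp
  qed
  \<comment> \<open>At 0 no derivative is available, only continuity from the right; the mean value
    theorem asks for no more.\<close>
  have MVT_0: "\<exists>\<xi>. 0 < \<xi> \<and> \<xi> < t \<and> 1 - c t = - c' \<xi> * t" if t: "0 < t" for t
  proof -
    have "continuous_on {0..t} c"
      unfolding continuous_on
    proof
      fix x
      assume x: "x \<in> {0..t}"
      show "(c \<longlongrightarrow> c x) (at x within {0..t})"
      proof (cases "x = 0")
        case True
        have "at 0 within {0..t} \<le> at_right 0"
          using t by (simp add: at_within_Icc_at_right)
        then show ?thesis
          using True c_0 tendsto_mono[OF _ c_lim_0] by simp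
      next
        case False
        then have "isCont c x"
          using x c_deriv[of x] by (auto intro: DERIV_isCont)
        then show ?thesis
          by (simp add: isCont_def Lim_at_imp_Lim_at_within)
      qed
    qed
    then obtain l \<xi> where \<xi>: "0 < \<xi>" "\<xi> < t" "DERIV c \<xi> :> l" "c t - c 0 = (t - 0) * l"
      using MVT[OF t, of c] c_deriv by (meson real_differentiable_def)
    moreover have "l = c' \<xi>"
      using DERIV_unique[OF \<xi>(3)] c_deriv \<xi>(1) by blast
    ultimately show ?thesis
      using c_0 by (intro exI[of _ \<xi>]) (auto simp: algebra_simps)
  qed
  \<comment> \<open>In terms of the angle \<open>arccos (r t)\<close>, \<open>1 - c t\<close> is the
    angle times \<open>2 / pi\<close> and \<open>q t\<close> is its sine.\<close>
  have q_ge: "1 - c t \<le> 4 * q t" if t: "0 < t" for t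
  proof -
    have r_abs: "\<bar>r t\<bar> \<le> 1"
      using i[OF t] r_le_1[of t] by simp
    have arccos: "0 \<le> arccos (r t)" "arccos (r t) \<le> pi / 2"
      using i[OF t] r_le_1[of t] arccos_lbound arccos_le_pi2 by auto
    have "1 - c t = 2 / pi * arccos (r t)"
      using r_abs by (simp add: c_def arccos_arcsin_eq field_simps)
    also have "\<dots> \<le> arccos (r t)"
      using arccos pi_gt3 by (intro mult_left_le_one_le) auto
    also have "\<dots> \<le> 4 * sin (arccos (r t))"
      using arccos by (rule le_4_sin)
    also have "sin (arccos (r t)) = q t"
      using r_abs by (simp add: q_def sin_arccos_abs)
    finally show ?thesis .
  qed
  \<comment> \<open>By convexity \<open>- c' t * t\<close> is at most \<open>1 - c t\<close>, hence
    at most \<open>4 * q t\<close>. Near 0, 1 - r^2 is at most 2 (1 - r), hence at most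
    \<open>2 * K * t\<^sup>2\<close>, which yields this constant; monotonicity of c' extends the
    bound to all \<open>t\<close>.\<close>
  define K' where "K' = 4 * sqrt (2 * K)"
  have c'_ge: "- K' \<le> c' t" if t: "0 < t" for t
  proof -
    have small: "- K' \<le> c' t" if t: "0 < t" "t < \<epsilon>" for t
    proof -
      obtain \<xi> where \<xi>: "0 < \<xi>" "\<xi> < t" "1 - c t = - c' \<xi> * t"
        using MVT_0[OF t(1)] by blast
      have "- c' t * t \<le> - c' \<xi> * t"
        using \<xi> t c'_mono[of \<xi> t] by (intro mult_right_mono) auto
      also have "\<dots> \<le> 4 * q t"
        using \<xi> q_ge[OF t(1)] by simp
      also have "q t \<le> sqrt (2 * K * t\<^sup>2)"
      proof -
        have "1 - (r t)\<^sup>2 = (1 - r t) * (1 + r t)"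
          by (simp add: power2_eq_square algebra_simps)
        also have "\<dots> \<le> (1 - r t) * 2"
          using r_le_1[of t] by (intro mult_left_mono) auto
        also have "\<dots> \<le> 2 * K * t\<^sup>2"
          using K_le[OF t] by simp
        finally show ?thesis
          unfolding q_def by (rule real_sqrt_le_mono)
      qed
      also have "4 * sqrt (2 * K * t\<^sup>2) = K' * t"
        using t by (simp add: K'_def real_sqrt_mult)
      finally have "- c' t \<le> K'"
        using t by (simp only: mult_le_cancel_right_pos)
      then show ?thesis
        by simp
    qed
    show ?thesis
    proof (cases "t < \<epsilon>")
      case False
      then show ?thesis
        using small[of "\<epsilon> / 2"] \<epsilon> c'_mono[of "\<epsilon> / 2" t] by simp
    qed (use small t in simp)
  qed
  define \<kappa> where "\<kappa> = 1 - c 1"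
  have \<kappa>: "0 < \<kappa>"
  proof -
    have "arcsin (r 1) < arcsin 1"
      using i[of 1] r_less_1[of 1] by (intro arcsin_less_arcsin) auto
    then show ?thesis
      by (simp add: \<kappa>_def c_def field_simps)
  qed
  \<comment> \<open>The function 1 - c is concave and vanishes at 0, so on [0, 1] it lies above its
    chord, whose slope is \<open>\<kappa>\<close>.\<close>
  have c_bound: "\<kappa> * t \<le> 1 - c t" if t: "0 < t" "t < 1" for t
  proof -
    obtain \<xi> where \<xi>: "0 < \<xi>" "\<xi> < t" "1 - c t = - c' \<xi> * t"
      using MVT_0[OF t(1)] by blast
    obtain \<eta> where \<eta>: "t < \<eta>" "\<eta> < 1" "c 1 - c t = (1 - t) * c' \<eta>"
      using MVT2[of t 1 c c'] c_deriv t by auto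
    have "(1 - t) * c' \<xi> \<le> (1 - t) * c' \<eta>"
      using \<xi> \<eta> t c'_mono[of \<xi> \<eta>] by (intro mult_left_mono) auto
    then have "\<kappa> \<le> - c' \<xi>"
      using \<xi>(3) \<eta>(3) by (simp add: \<kappa>_def algebra_simps)
    then show ?thesis
      unfolding \<xi>(3) using t by (intro mult_right_mono) auto
  qed
  have q_bound: "1 / q t \<le> 4 / \<kappa> * (1 + 1 / t)" if t: "0 < t" for t
  proof -
    \<comment> \<open>Below 1 the chord bound applies; from 1 on, \<open>q\<close> is at least
      \<open>q 1\<close> because r decreases.\<close>
    have "\<kappa> * min t 1 \<le> 4 * q t"
    proof (cases "t < 1")
      case True
      then show ?thesis
        using c_bound[of t] q_ge[OF t] t by simp
    next
      case False
      then have "r t \<le> r 1"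
        by (intro r_anti) auto
      then have "(r t)\<^sup>2 \<le> (r 1)\<^sup>2"
        using i[OF t] by (intro power_mono) auto
      then have "q 1 \<le> q t"
        by (simp add: q_def)
      then show ?thesis
        using q_ge[of 1] False by (simp add: \<kappa>_def)
    qed
    then have "1 / q t \<le> 4 / (\<kappa> * min t 1)"
      using q_pos[OF t] \<kappa> t by (simp add: field_simps)
    also have "\<dots> = 4 / \<kappa> * (1 / min t 1)"
      by simp
    also have "\<dots> \<le> 4 / \<kappa> * (1 + 1 / t)"
      using t \<kappa> by (intro mult_left_mono) (auto simp: min_def)
    finally show ?thesis .
  qed
  \<comment> \<open>\<open>2 * K\<close> bounds r''. The second summand bounds r'^2 r / (1 - r^2),
    because r' / q is \<open>pi / 2\<close> times the bounded c'. Only the outer factor 1 / q is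
    left, and it supplies \<open>4 / \<kappa>\<close> and the growth like 1/t.\<close>
  define L where "L = 2 / pi * (2 * K + (pi / 2 * K')\<^sup>2) * (4 / \<kappa>)"
  have "0 \<le> L"
    using K \<kappa> by (simp add: L_def)
  moreover have "c'' t \<le> L * (1 + 1 / t)" if t: "0 < t" for t
  proof -
    have "r' t / q t = pi / 2 * c' t"
      by (simp add: c'_def)
    then have "(r' t)\<^sup>2 / (1 - (r t)\<^sup>2) = (pi / 2 * c' t)\<^sup>2"
      unfolding q_sq[OF t, symmetric] by (simp only: power_divide[symmetric])
    also have "\<dots> \<le> (pi / 2 * K')\<^sup>2"
    proof (rule abs_le_square_iff[THEN iffD1])
      show "\<bar>pi / 2 * c' t\<bar> \<le> \<bar>pi / 2 * K'\<bar>"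
        unfolding abs_mult using c'_ge[OF t] c'_le[OF t] by (intro mult_left_mono) auto
    qed
    finally have "(r' t)\<^sup>2 / (1 - (r t)\<^sup>2) * r t \<le> (pi / 2 * K')\<^sup>2 * 1"
      using i[OF t] r_le_1[of t] by (intro mult_mono) auto
    then have "r'' t + (r' t)\<^sup>2 * r t / (1 - (r t)\<^sup>2) \<le> 2 * K + (pi / 2 * K')\<^sup>2"
      using r''_le[OF t] by simp
    then have "c'' t \<le> 2 / pi * ((2 * K + (pi / 2 * K')\<^sup>2) * (1 / q t))"
      unfolding c''_def using q_pos[OF t]
      by (intro mult_left_mono) (auto intro!: divide_right_mono)
    also have "\<dots> \<le> 2 / pi * ((2 * K + (pi / 2 * K')\<^sup>2) * (4 / \<kappa> * (1 + 1 / t)))"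
      using K by (intro mult_left_mono q_bound t) auto
    finally show ?thesis
      by (simp only: L_def mult.assoc)
  qed
  ultimately obtain f where f: "switching_density f" "switching_dist f \<in> GD 2"
    "\<forall>t. switch_covariance f t = c \<bar>t\<bar>"
    using switching_density_of_convex_covariance[OF c_deriv c'_deriv c'_le c'_ge c''_ge _ _ c_0 c_lim_0 c_lim]
    by blast
  have "r \<bar>t\<bar> = r t" for t
    using r_minus[of t] by (cases "0 \<le> t") auto
  with f show ?thesis
    by (intro exI[of _ f]) (simp add: c_def)
qed

end
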